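(* For each $n\ge5$, rowmotion on $\mathcal{IC}([2]\times[n])$ has orbits of the following sizes, containing in total $3n^2+5n-30$ interval-closed sets (below, "$\{(1,i)\}$ for $i\equiv\dots$" means all lower-chain singletons $\{(1,i)\}$, $1\le i\le n$, with $i$ in the stated residue classes mod $6$): - $n\equiv0\pmod6$: an orbit of size $n^2+3n-5$ containing all $\{(1,i)\}$ with $i\equiv2$; an orbit of size $n^2+n-12$ containing all $\{(1,i)\}$ with $i\equiv0,4$; an orbit of size $n^2+n-13$ containing all $\{(1,i)\}$ with $i\equiv1,3,5$, $i>1$. - $n\equiv1\pmod6$: an orbit of size $n^2+2n-9$ containing all $\{(1,i)\}$ with $i\equiv2,5$; an orbit of size $n^2+2n-9$ containing all $\{(1,i)\}$ with $i\equiv0,3$; an orbit of size $\frac{2n^2+n-27}{3}$ containing all $\{(1,i)\}$ with $i\equiv1,4$, $i>1$; an orbit of size $\frac{n^2+2n-9}{3}$ containing no singleton ICS, with representative $\{(1,n-2),(1,n-1)\}$. - $n\equiv2\pmod6$: an orbit of size $n^2+3n-4$ containing all $\{(1,i)\}$ with $i\equiv2,4$; an orbit of size $n^2+n-13$ containing all $\{(1,i)\}$ with $i\equiv0$; an orbit of size $n^2+n-13$ containing all $\{(1,i)\}$ with $i\equiv1,3,5$, $i>1$. - $n\equiv3\pmod6$: an orbit of size $2n^2+5n-13$ containing all $\{(1,i)\}$ with $i\equiv2,3,4,5$; an orbit of size $n^2-17$ containing all $\{(1,i)\}$ with $i\equiv0,1$, $i>1$. - $n\equiv4\pmod6$: an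 orbit of size $\frac{2n^2+4n-18}{3}$ containing all $\{(1,i)\}$ with $i\equiv0$; an orbit of size $\frac{2n^2+4n-18}{3}$ containing all $\{(1,i)\}$ with $i\equiv2$; an orbit of size $\frac{n^2+2n-6}{3}$ containing all $\{(1,i)\}$ with $i\equiv4$; an orbit of size $\frac{n^2+2n-9}{3}$ containing all $\{(1,i)\}$ with $i\equiv3$; an orbit of size $\frac{n^2+2n-9}{3}$ containing all $\{(1,i)\}$ with $i\equiv5$; an orbit of size $\frac{n^2-n-21}{3}$ containing all $\{(1,i)\}$ with $i\equiv1$, $i>1$; an orbit of size $\frac{n^2+2n-9}{3}$ containing no singleton ICS, with representative $\{(1,n-2),(1,n-1)\}$. - $n\equiv5\pmod6$: an orbit of size $2n^2+3n-21$ containing all $\{(1,i)\}$ with $i\equiv0,3,4,5$; an orbit of size $n^2+2n-9$ containing all $\{(1,i)\}$ with $i\equiv1,2$, $i>1$.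
   Context: $[2]\times[n]=\{(i,j): i\in\{1,2\},1\le j\le n\}$ with the componentwise order; the lower chain is $\{1\}\times[n]$. An interval-closed set (ICS) is a subset $I$ with $x,y\in I$, $x\le z\le y\Rightarrow z\in I$; $\mathcal{IC}(P)$ is the set of ICS. The toggle $t_x$ sends $I$ to $I\triangle\{x\}$ if this is an ICS, and to $I$ otherwise; rowmotion is $\mathrm{Row}=t_{x_1}\circ\cdots\circ t_{x_N}$ for any linear extension $x_1,\dots,x_N$ (toggles applied top to bottom). *)

theory Defs
  imports Complex_Main "HOL-Library.Product_Order" "HOL-Combinatorics.Orbits"
begin

text \<open>A poset is a subset \<open>P\<close> of a type of class \<open>order\<close>, with the induced order.\<close>

definition interval_closed_sets :: "'a::order set \<Rightarrow> 'a set set" where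
  "interval_closed_sets P =
     {I. I \<subseteq> P \<and> (\<forall>x\<in>I. \<forall>y\<in>I. \<forall>z\<in>P. x \<le> z \<and> z \<le> y \<longrightarrow> z \<in> I)}"

definition toggle :: "'a::order set \<Rightarrow> 'a \<Rightarrow> 'a set \<Rightarrow> 'a set" where
  "toggle P x I =
     (if sym_diff I {x} \<in> interval_closed_sets P then sym_diff I {x} else I)"

definition linear_extension :: "'a::order set \<Rightarrow> 'a list \<Rightarrow> bool" where
  "linear_extension P xs \<longleftrightarrow>
     distinct xs \<and> set xs = P \<and> sorted_wrt (\<lambda>x y. \<not> y < x) xs"

text \<open>
  \<open>foldr (toggle P) [x\<^sub>1, \<dots>, x\<^sub>N]\<close> is the composite of the toggles at
  \<open>x\<^sub>1, \<dots>, x\<^sub>N\<close> in which the toggle at \<open>x\<^sub>N\<close> acts first.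
  Linear extensions of a finite \<open>P\<close> exist, and on interval-closed sets the composite does not
  depend on which one is chosen: see \<open>linear_extension_exists\<close> and \<open>rowmotion_eq\<close>.
\<close>

definition rowmotion :: "'a::order set \<Rightarrow> 'a set \<Rightarrow> 'a set" where
  "rowmotion P = foldr (toggle P) (SOME xs. linear_extension P xs)"

text \<open>
  The library's \<open>orbit f I\<close> consists of the iterates \<open>(f ^^ k) I\<close> with \<open>k \<ge> 1\<close>; it contains \<open>I\<close>
  since rowmotion permutes the interval-closed sets of a finite poset: see
  \<open>bij_betw_rowmotion\<close> and \<open>in_orbit_rowmotion\<close>.
\<close>

definition rowmotion_orbits :: "'a::order set \<Rightarrow> 'a set set set" where
  "rowmotion_orbits P = orbit (rowmotion P) ` interval_closed_sets P"

text \<open>The order on pairs is the componentwise one from \<open>Product_Order\<close>.\<close>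

definition two_chain_product :: "nat \<Rightarrow> (nat \<times> nat) set" where
  "two_chain_product n = {1..2} \<times> {1..n}"

definition lower_singletons :: "nat \<Rightarrow> nat \<Rightarrow> nat set \<Rightarrow> (nat \<times> nat) set set" where
  "lower_singletons m n S = (\<lambda>i. {(1, i)}) ` {i \<in> {m..n}. i mod 6 \<in> S}"

lemma linear_extension_exists:
  assumes "finite (P :: 'a::order set)"
  shows "\<exists>xs. linear_extension P xs"
  using assms
proof (induction P rule: finite_psubset_induct)
  case (psubset P)
  show ?case
  proof (cases "P = {}")
    case True
    then show ?thesis by (auto simp: linear_extension_def)
  next
    case False
    then obtain x where x: "x \<in> P" "\<And>y. y \<in> P \<Longrightarrow> y \<le> x \<Longrightarrow> x = y"
      using finite_has_minimal[OF psubset.hyps(1)] by metis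
    have "P - {x} \<subset> P" using x(1) by blast
    then obtain xs where "linear_extension (P - {x}) xs" using psubset.IH by blast
    then have "linear_extension P (x # xs)"
      using x unfolding linear_extension_def
      by (auto simp: insert_absorb less_le)
    then show ?thesis ..
  qed
qed

lemma toggle_in: "I \<in> interval_closed_sets P \<Longrightarrow> toggle P x I \<in> interval_closed_sets P"
  by (auto simp: toggle_def)

lemma foldr_toggle_in:
  "I \<in> interval_closed_sets P \<Longrightarrow> foldr (toggle P) xs I \<in> interval_closed_sets P"
  by (induction xs) (auto simp: toggle_in)

lemma toggle_toggle: "I \<in> interval_closed_sets P \<Longrightarrow> toggle P x (toggle P x I) = I"
proof -
  have "sym_diff (sym_diff I {x}) {x} = I" by auto
  then show "I \<in> interval_closed_sets P \<Longrightarrow> ?thesis" by (auto simp: toggle_def)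
qed

lemma toggle_commute:
  assumes "I \<in> interval_closed_sets P" "\<not> x < y" "\<not> y < x"
  shows "toggle P x (toggle P y I) = toggle P y (toggle P x I)"
proof (cases "x = y")
  case False
  then have inc: "\<not> x \<le> y" "\<not> y \<le> x" using assms by auto
  have comm: "sym_diff (sym_diff I {x}) {y} = sym_diff (sym_diff I {y}) {x}" by auto
  have *: "sym_diff (sym_diff J {a}) {b} \<in> interval_closed_sets P \<longleftrightarrow>
           sym_diff J {a} \<in> interval_closed_sets P"
    if J: "J \<in> interval_closed_sets P" "sym_diff J {b} \<in> interval_closed_sets P"
      and ab: "\<not> a \<le> b" "\<not> b \<le> a" for a b J
  proof -
    have ne: "a \<noteq> b" using ab by auto
    have mem: "c \<in> sym_diff K {d} \<longleftrightarrow> (if c = d then c \<notin> K else c \<in> K)" for c d :: 'a and K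
      by auto
    have J1: "J \<subseteq> P" "\<And>u v w. u \<in> J \<Longrightarrow> v \<in> J \<Longrightarrow> w \<in> P \<Longrightarrow> u \<le> w \<Longrightarrow> w \<le> v \<Longrightarrow> w \<in> J"
      using J(1) unfolding interval_closed_sets_def by blast+
    have J2: "\<And>u. u \<in> sym_diff J {b} \<Longrightarrow> u \<in> P"
      "\<And>u v w. u \<in> sym_diff J {b} \<Longrightarrow> v \<in> sym_diff J {b} \<Longrightarrow> w \<in> P \<Longrightarrow> u \<le> w \<Longrightarrow> w \<le> v
         \<Longrightarrow> w \<in> sym_diff J {b}"
      using J(2) unfolding interval_closed_sets_def by blast+
    show ?thesis
    proof
      assume L: "sym_diff (sym_diff J {a}) {b} \<in> interval_closed_sets P"
      have L1: "\<And>u. u \<in> sym_diff (sym_diff J {a}) {b} \<Longrightarrow> u \<in> P"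
        "\<And>u v w. u \<in> sym_diff (sym_diff J {a}) {b} \<Longrightarrow> v \<in> sym_diff (sym_diff J {a}) {b}
           \<Longrightarrow> w \<in> P \<Longrightarrow> u \<le> w \<Longrightarrow> w \<le> v \<Longrightarrow> w \<in> sym_diff (sym_diff J {a}) {b}"
        using L unfolding interval_closed_sets_def by blast+
      show "sym_diff J {a} \<in> interval_closed_sets P"
        unfolding interval_closed_sets_def
      proof (intro CollectI conjI subsetI ballI impI)
        fix u assume "u \<in> sym_diff J {a}"
        then show "u \<in> P" using J1(1) L1(1)[of u] ne unfolding mem by (auto split: if_splits)
      next
        fix u v w assume "u \<in> sym_diff J {a}" "v \<in> sym_diff J {a}" "w \<in> P" "u \<le> w \<and> w \<le> v"
        then show "w \<in> sym_diff J {a}"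
          using J1(2)[of u v w] J2(2)[of u v w] L1(2)[of u v w] ab ne unfolding mem
          by (smt (verit) order_trans order_refl)
      qed
    next
      assume L: "sym_diff J {a} \<in> interval_closed_sets P"
      have L1: "\<And>u. u \<in> sym_diff J {a} \<Longrightarrow> u \<in> P"
        "\<And>u v w. u \<in> sym_diff J {a} \<Longrightarrow> v \<in> sym_diff J {a} \<Longrightarrow> w \<in> P \<Longrightarrow> u \<le> w \<Longrightarrow> w \<le> v
           \<Longrightarrow> w \<in> sym_diff J {a}"
        using L unfolding interval_closed_sets_def by blast+
      show "sym_diff (sym_diff J {a}) {b} \<in> interval_closed_sets P"
        unfolding interval_closed_sets_def
      proof (intro CollectI conjI subsetI ballI impI)
        fix u assume "u \<in> sym_diff (sym_diff J {a}) {b}"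
        then show "u \<in> P" using J1(1) J2(1)[of u] L1(1)[of u] ne unfolding mem
          by (auto split: if_splits)
      next
        fix u v w assume "u \<in> sym_diff (sym_diff J {a}) {b}" "v \<in> sym_diff (sym_diff J {a}) {b}"
          "w \<in> P" "u \<le> w \<and> w \<le> v"
        then show "w \<in> sym_diff (sym_diff J {a}) {b}"
          using J1(2)[of u v w] J2(2)[of u v w] L1(2)[of u v w] ab ne unfolding mem
          by (smt (verit) order_trans order_refl)
      qed
    qed
  qed
  have "sym_diff (sym_diff I {x}) {y} \<in> interval_closed_sets P \<longleftrightarrow>
        sym_diff I {x} \<in> interval_closed_sets P"
    if "sym_diff I {y} \<in> interval_closed_sets P"
    using *[OF assms(1) that] inc by blast
  moreover have "sym_diff (sym_diff I {x}) {y} \<in> interval_closed_sets P \<longleftrightarrow>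
        sym_diff I {y} \<in> interval_closed_sets P"
    if "sym_diff I {x} \<in> interval_closed_sets P"
    unfolding comm using *[OF assms(1) that] inc by blast
  ultimately show ?thesis
    unfolding toggle_def using comm by (simp del: Un_iff Diff_iff)
qed simp

lemma foldr_toggle_unique:
  assumes "distinct xs" "sorted_wrt (\<lambda>x y. \<not> y < x) xs"
    and "distinct ys" "sorted_wrt (\<lambda>x y. \<not> y < x) ys"
    and "set xs = set ys" "I \<in> interval_closed_sets P"
  shows "foldr (toggle P) xs I = foldr (toggle P) ys I"
  using assms
proof (induction xs arbitrary: ys)
  case (Cons x xs)
  then obtain as bs where ys: "ys = as @ x # bs"
    by (metis list.set_intros(1) split_list)
  have inc: "\<not> x < a" "\<not> a < x" if "a \<in> set as" for a
    using Cons.prems that unfolding ys by (auto simp: sorted_wrt_append)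
  have pull: "foldr (toggle P) as (toggle P x J) = toggle P x (foldr (toggle P) as J)"
    if "J \<in> interval_closed_sets P" for J
    using inc
  proof (induction as)
    case (Cons a as)
    then show ?case
      using toggle_commute[of "foldr (toggle P) as J" P x a] foldr_toggle_in[OF that]
      by auto
  qed simp
  have "foldr (toggle P) xs I = foldr (toggle P) (as @ bs) I"
  proof (rule Cons.IH)
    show "set xs = set (as @ bs)"
      using Cons.prems unfolding ys by auto
  qed (use Cons.prems in \<open>auto simp: ys sorted_wrt_append\<close>)
  then show ?case
    using pull[OF foldr_toggle_in[OF Cons.prems(6)], of bs] by (simp add: ys)
qed simp

lemma rowmotion_eq:
  assumes "linear_extension P xs" "I \<in> interval_closed_sets P"
  shows "rowmotion P I = foldr (toggle P) xs I"
proof -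
  have "linear_extension P (SOME xs. linear_extension P xs)"
    using assms(1) by (rule someI)
  then show ?thesis
    using assms unfolding rowmotion_def linear_extension_def
    by (intro foldr_toggle_unique) auto
qed

lemma bij_betw_rowmotion:
  "bij_betw (rowmotion P) (interval_closed_sets P) (interval_closed_sets P)"
proof -
  have "bij_betw (toggle P x) (interval_closed_sets P) (interval_closed_sets P)" for x
    by (rule bij_betw_byWitness[where f' = "toggle P x"]) (auto simp: toggle_toggle toggle_in)
  then have "bij_betw (foldr (toggle P) xs) (interval_closed_sets P) (interval_closed_sets P)" for xs
  proof (induction xs)
    case (Cons x xs)
    from bij_betw_trans[OF Cons.IH[OF Cons.prems] Cons.prems[of x]] show ?case by (simp add: comp_def)
  qed (simp add: bij_betw_id)
  then show ?thesis by (simp add: rowmotion_def)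
qed

lemma in_orbit_rowmotion:
  assumes "finite P" "I \<in> interval_closed_sets P"
  shows "I \<in> orbit (rowmotion P) I"
proof -
  let ?A = "interval_closed_sets P" and ?f = "rowmotion P"
  have fin: "finite ?A"
    by (rule finite_subset[of _ "Pow P"]) (use assms(1) in \<open>auto simp: interval_closed_sets_def\<close>)
  have bij: "bij_betw (?f ^^ k) ?A ?A" for k
    using bij_betw_rowmotion bij_betw_funpow by blast
  have "range (\<lambda>k. (?f ^^ k) I) \<subseteq> ?A"
    using bij assms(2) by (auto dest: bij_betw_apply)
  then have "\<not> inj (\<lambda>k. (?f ^^ k) I)"
    using finite_subset[OF _ fin] finite_imageD[of _ "UNIV :: nat set"] by auto
  then obtain j k where jk: "j < k" "(?f ^^ j) I = (?f ^^ k) I"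
    unfolding inj_on_def by (metis linorder_neqE_nat)
  then have "(?f ^^ j) I = (?f ^^ j) ((?f ^^ (k - j)) I)"
    using funpow_add[of j "k - j" ?f] by simp
  moreover have "(?f ^^ (k - j)) I \<in> ?A"
    using bij assms(2) by (auto dest: bij_betw_apply)
  ultimately have "I = (?f ^^ (k - j)) I"
    by (rule inj_onD[OF bij_betw_imp_inj_on[OF bij[of j]] _ assms(2)])
  then show ?thesis
    using jk(1) unfolding orbit_altdef
    by (intro CollectI exI[of _ "k - j"] conjI) simp_all
qed

end

theory Submission
  imports Defs
begin

text \<open>
  Rowmotion sends an interval-closed set consisting of a lower and an upper interval to another one,
  and outside a few boundary situations it just shifts both intervals up by one. The orbits in
  question are therefore followed through a section: the states of the three families \<open>Low\<close>, \<open>Diag\<close>,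
  \<open>Full\<close> below, the only ones in these orbits that contain \<open>(1, 1)\<close>. Between two visits to the section
  lie \<open>n + 1\<close> to \<open>n + 4\<close> steps, and the first-return map decreases the parameter by 6 (every second
  visit, for \<open>Low\<close> and \<open>Full\<close>) or by 3 (for \<open>Diag\<close>), except at nine final states. So the section falls
  into nine classes, which the return map joins end to end in cycles depending only on \<open>n mod 6\<close>;
  the size of an orbit is the sum of the return times over its classes. The singleton \<open>{(1, i)}\<close> runs
  straight into the state \<open>Full (n - i)\<close>, which decides its orbit.
\<close>


subsection \<open>Rowmotion chain by chain\<close>

text \<open>A lower interval \<open>{a..b}\<close> standing alone crosses into the upper interval
  \<open>{n - b + 1..n - b + a}\<close>: its start becomes a length, and its length fixes the
  distance from the top. If at least three places are free above, three more steps turn that upper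
  interval into a lower one three places higher, which crosses again. Two crossings restore the
  roles up to this shift by 3, the source of the moduli 3 and 6. With fewer free places the section
  is reached after a single crossing; this gives the thresholds at 4 and the final states. On
  arrival the distance 0, 1 or 2 of the upper interval from the top selects \<open>Full\<close>,
  \<open>Diag\<close> or \<open>Low\<close>. Marking the section by membership of
  \<open>(1, 1)\<close> spares all comparison of intermediate states: they avoid
  \<open>(1, 1)\<close>, and a bijection cannot merge two paths. The total does not depend on
  \<open>n mod 6\<close> because every residue uses all nine classes: \<open>Full\<close>,
  \<open>Low\<close> and \<open>Diag\<close> contribute (n-1)(n+4) - 11, (n-2)(n+2) - 2 and
  (n-1)(n+3) - 6.\<close>

definition rows :: "nat set \<Rightarrow> nat set \<Rightarrow> (nat \<times> nat) set" where
  "rows L U = {1} \<times> L \<union> {2} \<times> U"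

definition ics :: "nat \<Rightarrow> nat set \<Rightarrow> nat set \<Rightarrow> bool" where
  "ics n L U \<longleftrightarrow> rows L U \<in> interval_closed_sets (two_chain_product n)"

lemma mem_rows: "(r, k) \<in> rows L U \<longleftrightarrow> r = 1 \<and> k \<in> L \<or> r = 2 \<and> k \<in> U"
  by (auto simp: rows_def)

text \<open>Each row is a chain, and across the rows only \<open>(1, i) \<le> (2, j)\<close> with
  \<open>i \<le> j\<close> occurs. The mixed condition asks for both copies of \<open>k\<close>
  because both lie between such a pair.\<close>

lemma ics_iff:
  "ics n L U \<longleftrightarrow> L \<subseteq> {1..n} \<and> U \<subseteq> {1..n} \<and>
     (\<forall>i\<in>L. \<forall>j\<in>L. \<forall>k. i \<le> k \<and> k \<le> j \<longrightarrow> k \<in> L) \<and>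
     (\<forall>i\<in>U. \<forall>j\<in>U. \<forall>k. i \<le> k \<and> k \<le> j \<longrightarrow> k \<in> U) \<and>
     (\<forall>i\<in>L. \<forall>j\<in>U. \<forall>k. i \<le> k \<and> k \<le> j \<longrightarrow> k \<in> L \<and> k \<in> U)"
  (is "_ \<longleftrightarrow> ?R")
proof
  assume "ics n L U"
  then have sub: "\<And>x. x \<in> rows L U \<Longrightarrow> x \<in> two_chain_product n"
    and conv: "\<And>x y z. x \<in> rows L U \<Longrightarrow> y \<in> rows L U \<Longrightarrow> z \<in> two_chain_product n
       \<Longrightarrow> x \<le> z \<Longrightarrow> z \<le> y \<Longrightarrow> z \<in> rows L U"
    unfolding ics_def interval_closed_sets_def by blast+
  have L: "L \<subseteq> {1..n}" and U: "U \<subseteq> {1..n}"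
    using sub[of "(1, i)" for i] sub[of "(2, i)" for i]
    by (simp_all add: mem_rows two_chain_product_def subset_iff)
  have mid: "k \<in> {1..n}" if "i \<in> L \<union> U" "j \<in> L \<union> U" "i \<le> k \<and> k \<le> j" for i j k
  proof -
    have "i \<in> {1..n}" "j \<in> {1..n}" using that L U by blast+
    then show ?thesis using that(3) by auto
  qed
  have LL: "k \<in> L" if "i \<in> L" "j \<in> L" "i \<le> k \<and> k \<le> j" for i j k
    using conv[of "(1, i)" "(1, j)" "(1, k)"] that mid[of i j k] by (simp add: mem_rows two_chain_product_def)
  have UU: "k \<in> U" if "i \<in> U" "j \<in> U" "i \<le> k \<and> k \<le> j" for i j k
    using conv[of "(2, i)" "(2, j)" "(2, k)"] that mid[of i j k] by (simp add: mem_rows two_chain_product_def)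
  have LU: "k \<in> L \<and> k \<in> U" if "i \<in> L" "j \<in> U" "i \<le> k \<and> k \<le> j" for i j k
    using conv[of "(1, i)" "(2, j)" "(1, k)"] conv[of "(1, i)" "(2, j)" "(2, k)"] that mid[of i j k]
    by (simp add: mem_rows two_chain_product_def)
  show ?R
    by (intro conjI[OF L] conjI[OF U] conjI ballI allI impI)
      (rule LL UU LU[THEN conjunct1] LU[THEN conjunct2]; assumption)+
next
  assume R: ?R
  then have LL: "\<And>i j k. i \<in> L \<Longrightarrow> j \<in> L \<Longrightarrow> i \<le> k \<and> k \<le> j \<Longrightarrow> k \<in> L"
    and UU: "\<And>i j k. i \<in> U \<Longrightarrow> j \<in> U \<Longrightarrow> i \<le> k \<and> k \<le> j \<Longrightarrow> k \<in> U"
    and LU: "\<And>i j k. i \<in> L \<Longrightarrow> j \<in> U \<Longrightarrow> i \<le> k \<and> k \<le> j \<Longrightarrow> k \<in> L \<and> k \<in> U"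
    by blast+
  have "z \<in> rows L U" if xy: "x \<in> rows L U" "y \<in> rows L U" "x \<le> z \<and> z \<le> y" for x y z
  proof -
    obtain a i b j c k where xyz: "x = (a, i)" "y = (b, j)" "z = (c, k)" by (metis surj_pair)
    have "a \<le> c" "c \<le> b" and le: "i \<le> k \<and> k \<le> j" using xy xyz by auto
    consider "a = 1" "i \<in> L" "b = 1" "j \<in> L" | "a = 1" "i \<in> L" "b = 2" "j \<in> U"
      | "a = 2" "i \<in> U" "b = 2" "j \<in> U" | "a = 2" "b = 1"
      using xy unfolding xyz mem_rows by blast
    then show ?thesis
    proof cases
      case 1
      with \<open>a \<le> c\<close> \<open>c \<le> b\<close> LL[OF _ _ le] show ?thesis by (simp add: xyz mem_rows)
    next
      case 2
      with \<open>a \<le> c\<close> \<open>c \<le> b\<close> have "c = 1 \<or> c = 2" by linarith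
      with 2 LU[OF _ _ le] show ?thesis by (simp add: xyz mem_rows)
    next
      case 3
      with \<open>a \<le> c\<close> \<open>c \<le> b\<close> UU[OF _ _ le] show ?thesis by (simp add: xyz mem_rows)
    qed (use \<open>a \<le> c\<close> \<open>c \<le> b\<close> in linarith)
  qed
  moreover have "rows L U \<subseteq> two_chain_product n"
    using conjunct1[OF R] conjunct1[OF conjunct2[OF R]] by (auto simp: rows_def two_chain_product_def)
  ultimately show "ics n L U" unfolding ics_def interval_closed_sets_def by blast
qed

text \<open>The predicate \<open>A\<close> singles out the states of one chain that are admissible while the other chain is fixed.\<close>

definition flip :: "(nat set \<Rightarrow> bool) \<Rightarrow> nat \<Rightarrow> nat set \<Rightarrow> nat set" where
  "flip A j S = (if A (sym_diff S {j}) then sym_diff S {j} else S)"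

definition sweep :: "nat \<Rightarrow> (nat set \<Rightarrow> bool) \<Rightarrow> nat set \<Rightarrow> nat set" where
  "sweep n A = foldr (flip A) [1..<Suc n]"

text \<open>\<open>S j\<close> is the chain after the toggles at \<open>n\<close> down to
  \<open>Suc j\<close>, since the sweep runs from the top. A closed form for all intermediate states
  reduces a sweep to single flips.\<close>

lemma sweep_eqI:
  assumes "S n = U" "\<And>j. j < n \<Longrightarrow> flip A (Suc j) (S (Suc j)) = S j"
  shows "sweep n A U = S 0"
proof -
  have "foldr (flip A) [Suc k..<Suc n] U = S k" if "k \<le> n" for k
    using that
  proof (induction rule: inc_induct)
    case base
    then show ?case using assms(1) by simp
  next
    case (step m)
    then show ?case using assms(2) by (simp add: upt_conv_Cons del: upt_Suc)
  qed
  from this[of 0] show ?thesis by (simp add: sweep_def)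
qed

text \<open>The whole lower chain followed by the whole upper one is a linear extension. Toggling
  from the top thus finishes the upper chain against the old \<open>L\<close> before the lower chain
  is swept against the new \<open>U'\<close>.\<close>

lemma rowmotion_rows:
  assumes "ics n L U"
  defines "U' \<equiv> sweep n (ics n L) U"
  shows "rowmotion (two_chain_product n) (rows L U) = rows (sweep n (\<lambda>S. ics n S U') L) U'"
proof -
  let ?P = "two_chain_product n"
  let ?xs = "map (Pair 1) [1..<Suc n] @ map (Pair 2) [1..<Suc n] :: (nat \<times> nat) list"
  have "linear_extension ?P ?xs"
    unfolding linear_extension_def
  proof (intro conjI)
    have "{1..2::nat} = {1, 2}" by auto
    then show "set ?xs = ?P" unfolding two_chain_product_def by auto
    show "distinct ?xs" by (auto simp: distinct_map inj_on_def)
    have "sorted_wrt (\<lambda>x y. \<not> y < x) (map (Pair a) [1..<Suc n])" for a :: nat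
      by (auto simp: sorted_wrt_iff_nth_less less_le less_eq_prod_def simp del: upt_Suc)
    then show "sorted_wrt (\<lambda>x y. \<not> y < x) ?xs"
      by (auto simp: sorted_wrt_append less_le less_eq_prod_def simp del: upt_Suc)
  qed
  then have row: "rowmotion ?P (rows L U) = foldr (toggle ?P) ?xs (rows L U)"
    using assms(1) rowmotion_eq unfolding ics_def by blast
  have d1: "sym_diff (rows S T) {(1, j)} = rows (sym_diff S {j}) T" for S T j
    by (auto simp: rows_def)
  have d2: "sym_diff (rows S T) {(2, j)} = rows S (sym_diff T {j})" for S T j
    by (auto simp: rows_def)
  have "toggle ?P (2, j) (rows S T) = rows S (flip (ics n S) j T)" for S T j
    by (simp only: toggle_def d2 ics_def flip_def split: if_split) simp
  then have t2: "foldr (toggle ?P) (map (Pair 2) js) (rows S T) = rows S (foldr (flip (ics n S)) js T)"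
    for S T js
    by (induction js) (simp_all only: list.map foldr.simps id_apply comp_apply)
  have "toggle ?P (1, j) (rows S T) = rows (flip (\<lambda>S. ics n S T) j S) T" for S T j
    by (simp only: toggle_def d1 ics_def flip_def split: if_split) simp
  then have t1: "foldr (toggle ?P) (map (Pair 1) js) (rows S T) =
      rows (foldr (flip (\<lambda>S. ics n S T)) js S) T" for S T js
    by (induction js) (simp_all only: list.map foldr.simps id_apply comp_apply)
  show ?thesis
    unfolding row foldr_append comp_apply t2 t1 U'_def sweep_def ..
qed

text \<open>If \<open>d < a\<close>, no lower point is below an upper one. Otherwise everything from
  \<open>a\<close> to \<open>d\<close> has to be in both rows, which for intervals amounts to
  \<open>c \<le> a\<close> and \<open>d \<le> b\<close>.\<close>

lemma ics_interval:
  "ics n {a..b} {c..d} \<longleftrightarrow> (a \<le> b \<longrightarrow> 1 \<le> a \<and> b \<le> n) \<and> (c \<le> d \<longrightarrow> 1 \<le> c \<and> d \<le> n) \<and>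
     (a \<le> b \<and> c \<le> d \<longrightarrow> d < a \<or> c \<le> a \<and> d \<le> b)"
proof -
  have conv: "\<forall>i\<in>{u..v}. \<forall>j\<in>{u..v}. \<forall>k. i \<le> k \<and> k \<le> j \<longrightarrow> k \<in> {u..v}" for u v :: nat
    by auto
  have "(\<forall>i\<in>{a..b}. \<forall>j\<in>{c..d}. \<forall>k. i \<le> k \<and> k \<le> j \<longrightarrow> k \<in> {a..b} \<and> k \<in> {c..d}) \<longleftrightarrow>
      (a \<le> b \<and> c \<le> d \<longrightarrow> d < a \<or> c \<le> a \<and> d \<le> b)" (is "?l = ?r")
  proof
    assume ?l
    have "d < a \<or> c \<le> a \<and> d \<le> b" if "a \<le> b" "c \<le> d"
    proof (cases "d < a")
      case False
      have "\<And>k. a \<le> k \<and> k \<le> d \<Longrightarrow> k \<in> {a..b} \<and> k \<in> {c..d}"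
        using \<open>?l\<close> that by (meson atLeastAtMost_iff order_refl)
      from this[of a] this[of d] False show ?thesis by simp
    qed simp
    then show ?r by blast
  next
    assume ?r
    then show ?l by fastforce
  qed
  then show ?thesis
    unfolding ics_iff by (simp only: conv) auto
qed

lemma ics_convex:
  assumes "ics n L U"
  shows "i \<in> L \<Longrightarrow> j \<in> L \<Longrightarrow> i \<le> k \<Longrightarrow> k \<le> j \<Longrightarrow> k \<in> L"
    and "i \<in> U \<Longrightarrow> j \<in> U \<Longrightarrow> i \<le> k \<Longrightarrow> k \<le> j \<Longrightarrow> k \<in> U"
  using assms unfolding ics_iff by blast+

section \<open>Sweeps of a chain whose state is an interval\<close>

context
  fixes n :: nat and A :: "nat set \<Rightarrow> bool"
  assumes convex: "\<And>S i j k. A S \<Longrightarrow> i \<in> S \<Longrightarrow> j \<in> S \<Longrightarrow> i \<le> k \<Longrightarrow> k \<le> j \<Longrightarrow> k \<in> S"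
begin

lemma flip_interval:
  assumes "c \<le> d"
  shows "flip A j {c..d} =
    (if j = Suc d \<and> A {c..j} then {c..j} else if Suc j = c \<and> A {j..d} then {j..d}
     else if j = c \<and> A {Suc c..d} then {Suc c..d} else if j = d \<and> A {c..d - 1} then {c..d - 1} else {c..d})"
proof -
  consider "j = Suc d" | "Suc j = c" | "j = c" | "j = d" "j \<noteq> c" | "Suc j < c" | "Suc d < j" | "c < j" "j < d"
    by linarith
  then show ?thesis
  proof cases
    case 1
    then have "sym_diff {c..d} {j} = {c..j}" using assms by auto
    then show ?thesis using 1 assms by (simp add: flip_def)
  next
    case 2
    then have "sym_diff {c..d} {j} = {j..d}" using assms by auto
    then show ?thesis using 2 assms by (simp add: flip_def)
  next
    case 3
    then have "sym_diff {c..d} {j} = {Suc c..d}" using assms by auto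
    then show ?thesis using 3 assms by (cases "c = d"; cases d) (simp_all add: flip_def)
  next
    case 4
    then have "sym_diff {c..d} {j} = {c..d - 1}" using assms by auto
    then show ?thesis using 4 assms by (simp add: flip_def)
  next
    case 5
    then have "\<not> A (sym_diff {c..d} {j})"
      using assms convex[of "sym_diff {c..d} {j}" j c "Suc j"] by auto
    then show ?thesis using 5 assms by (simp add: flip_def)
  next
    case 6
    then have "\<not> A (sym_diff {c..d} {j})"
      using assms convex[of "sym_diff {c..d} {j}" d j "Suc d"] by auto
    then show ?thesis using 6 assms by (simp add: flip_def)
  next
    case 7
    then have "\<not> A (sym_diff {c..d} {j})"
      using assms convex[of "sym_diff {c..d} {j}" c d j] by auto
    then show ?thesis using 7 assms by (simp add: flip_def)
  qed
qed

lemma flip_empty: "flip A j {} = (if A {j} then {j} else {})"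
  by (simp add: flip_def)

text \<open>The point above the top is added first. Once \<open>c\<close> has been removed, no
  smaller point is adjacent to the interval, so the sweep is over.\<close>

lemma sweep_shift:
  assumes "1 \<le> c" "c \<le> d" "d < n" "A {c..Suc d}" "A {Suc c..Suc d}"
  shows "sweep n A {c..d} = {Suc c..Suc d}"
proof -
  let ?S = "\<lambda>j. if d < j then {c..d} else if c \<le> j then {c..Suc d} else {Suc c..Suc d}"
  have "sweep n A {c..d} = ?S 0"
    by (rule sweep_eqI[where S = ?S]) (use assms in \<open>auto simp: flip_interval less_Suc_eq\<close>)
  then show ?thesis using assms by simp
qed

text \<open>Since \<open>c\<close> cannot be removed, its predecessor is adjacent when its turn
  comes and is added, and so on down to 1.\<close>

lemma sweep_stretch:
  assumes "1 \<le> c" "c \<le> d" "d < n" "\<not> A {Suc c..Suc d}" "\<And>k. 1 \<le> k \<Longrightarrow> k \<le> c \<Longrightarrow> A {k..Suc d}"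
  shows "sweep n A {c..d} = {1..Suc d}"
proof -
  let ?S = "\<lambda>j. if d < j then {c..d} else if c \<le> j then {c..Suc d} else {Suc j..Suc d}"
  have "flip A (Suc j) (?S (Suc j)) = ?S j" if "j < n" for j
  proof -
    consider "d < j" | "j = d" | "c \<le> j" "j < d" | "Suc j = c" | "Suc j < c" by linarith
    then show ?thesis
      apply cases
      subgoal using assms by (simp add: flip_interval)
      subgoal using assms assms(5)[of c] by (simp add: flip_interval)
      subgoal using assms by (simp add: flip_interval)
      subgoal using assms by (simp add: flip_interval)
      subgoal using assms assms(5)[of "Suc j"] by (simp add: flip_interval)
      done
  qed
  then have "sweep n A {c..d} = ?S 0"
    using assms by (intro sweep_eqI[where S = ?S]) auto
  then show ?thesis using assms by simp
qed

text \<open>Growth is blocked, so the interval is eaten from its top and is empty when the sweep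
  reaches \<open>e\<close>; there a new interval starts and grows downward to \<open>l\<close>. For
  \<open>e = 0\<close> nothing regrows.\<close>

lemma sweep_drop:
  assumes "e < d" "d \<le> n" "d = n \<or> \<not> A {Suc e..Suc d}" "l = 1 \<or> 1 < l \<and> l \<le> e \<and> \<not> A {l - 1..e}"
    and "\<And>k. e \<le> k \<Longrightarrow> k < d \<Longrightarrow> A {Suc e..k}" "\<And>k. l \<le> k \<Longrightarrow> k \<le> e \<Longrightarrow> A {k..e}"
  shows "sweep n A {Suc e..d} = {l..e}"
proof -
  let ?S = "\<lambda>j. if d < j then {Suc e..d} else if e < j then {Suc e..j} else if l \<le> Suc j then {Suc j..e} else {l..e}"
  have "flip A (Suc j) (?S (Suc j)) = ?S j" if "j < n" for j
  proof -
    \<comment> \<open>For \<open>k = e\<close> the interval \<open>{Suc e..k}\<close> in the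
      assumption is empty.\<close>
    have A0: "A {}" using assms(5)[of e] assms(1) by simp
    consider "d < j" | "j = d" | "e < j" "j < d" | "j = e" | "j < e" "l \<le> Suc j" | "j < e" "l = Suc (Suc j)" | "j < e" "Suc (Suc j) < l"
      by linarith
    then show ?thesis
      apply cases
      subgoal using assms by (simp add: flip_interval flip_empty)
      subgoal using assms that by (simp add: flip_interval flip_empty)
      subgoal using assms A0 that assms(5)[of j] by (simp add: flip_interval flip_empty)
      subgoal using assms A0 that flip_interval[of "Suc e" "Suc e" "Suc e"] by simp
      subgoal using assms A0 that assms(6)[of "Suc j"] by (cases "Suc j = e") (auto simp add: flip_interval flip_empty)
      subgoal using assms A0 that by (simp add: flip_interval flip_empty)
      subgoal using assms A0 that by (simp add: flip_interval flip_empty)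
      done
  qed
  then have "sweep n A {Suc e..d} = ?S 0"
    using assms by (intro sweep_eqI[where S = ?S]) auto
  then show ?thesis using assms by auto
qed

lemma sweep_fill:
  assumes "l \<le> e" "e \<le> n" "\<And>k. e < k \<Longrightarrow> k \<le> n \<Longrightarrow> \<not> A {k}" "\<And>k. l \<le> k \<Longrightarrow> k \<le> e \<Longrightarrow> A {k..e}"
    and "l = 1 \<or> 1 < l \<and> \<not> A {l - 1..e}"
  shows "sweep n A {} = {l..e}"
proof -
  let ?S = "\<lambda>j. if e \<le> j then {} else if l \<le> Suc j then {Suc j..e} else {l..e}"
  have "flip A (Suc j) (?S (Suc j)) = ?S j" if "j < n" for j
  proof -
    consider "e \<le> j" | "Suc j = e" | "Suc j < e" "l \<le> Suc j" | "l = Suc (Suc j)" | "Suc (Suc j) < l"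
      by linarith
    then show ?thesis
      apply cases
      subgoal using assms that by (simp add: flip_interval flip_empty)
      subgoal using assms that assms(4)[of e] by (simp add: flip_interval flip_empty)
      subgoal using assms that assms(4)[of "Suc j"] by (simp add: flip_interval flip_empty)
      subgoal using assms that by (simp add: flip_interval flip_empty)
      subgoal using assms that by (simp add: flip_interval flip_empty)
      done
  qed
  then have "sweep n A {} = ?S 0"
    using assms by (intro sweep_eqI[where S = ?S]) auto
  then show ?thesis using assms by auto
qed

text \<open>Points are shed from \<open>n\<close> downward until the removal of \<open>e\<close> is
  blocked; the lower end \<open>c\<close> then goes as well. For \<open>c = e\<close> both ends meet
  and the chain becomes empty.\<close>

lemma sweep_shrink:
  assumes "1 \<le> c" "c \<le> e" "e \<le> n" "\<And>k. e \<le> k \<Longrightarrow> k < n \<Longrightarrow> A {c..k}" "c < e \<Longrightarrow> \<not> A {c..e - 1}"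
    "A {Suc c..e}" "c = e \<Longrightarrow> \<forall>k<c. \<not> A {k}"
  shows "sweep n A {c..n} = {Suc c..e}"
proof -
  let ?S = "\<lambda>j. if e \<le> j then {c..j} else if c \<le> j then {c..e} else {Suc c..e}"
  have "flip A (Suc j) (?S (Suc j)) = ?S j" if "j < n" for j
  proof -
    consider "e \<le> j" | "Suc j = e" | "c \<le> j" "Suc j < e" | "Suc j = c" "c < e" | "Suc j < c"
      using assms by linarith
    then show ?thesis
      apply cases
      subgoal using assms that assms(4)[of j] by (simp add: flip_interval flip_empty)
      subgoal using assms that by (simp add: flip_interval flip_empty)
      subgoal using assms that by (simp add: flip_interval flip_empty)
      subgoal using assms that by (simp add: flip_interval flip_empty)
      subgoal using assms that by (cases "c = e") (auto simp add: flip_interval flip_empty)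
      done
  qed
  then have "sweep n A {c..n} = ?S 0"
    using assms by (intro sweep_eqI[where S = ?S]) auto
  then show ?thesis using assms by auto
qed

end

subsection \<open>One step of rowmotion on pairs of intervals\<close>

text \<open>Simplification turns \<open>{1..0}\<close> and \<open>{k..k}\<close> into
  \<open>{}\<close> and \<open>{k}\<close>, which \<open>ics_interval\<close> no longer matches;
  these are its instances in that form.\<close>

lemma ics_simps:
  "ics n {a..b} {} \<longleftrightarrow> (a \<le> b \<longrightarrow> 1 \<le> a \<and> b \<le> n)"
  "ics n {} {c..d} \<longleftrightarrow> (c \<le> d \<longrightarrow> 1 \<le> c \<and> d \<le> n)"
  "ics n {} {}"
  "ics n {} {k} \<longleftrightarrow> 1 \<le> k \<and> k \<le> n"
  "ics n {a..b} {k} \<longleftrightarrow> (a \<le> b \<longrightarrow> 1 \<le> a \<and> b \<le> n) \<and> 1 \<le> k \<and> k \<le> n \<and>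
     (a \<le> b \<longrightarrow> k < a \<or> k \<le> a \<and> k \<le> b)"
  "ics n {k} {} \<longleftrightarrow> 1 \<le> k \<and> k \<le> n"
  "ics n {k} {c..d} \<longleftrightarrow> (c \<le> d \<longrightarrow> 1 \<le> c \<and> d \<le> n) \<and> 1 \<le> k \<and> k \<le> n \<and>
     (c \<le> d \<longrightarrow> d < k \<or> c \<le> k \<and> d \<le> k)"
  using ics_interval[of n a b 1 0] ics_interval[of n 1 0 c d] ics_interval[of n 1 0 1 0]
    ics_interval[of n 1 0 k k] ics_interval[of n a b k k] ics_interval[of n k k 1 0]
    ics_interval[of n k k c d]
  by auto

lemmas ics_box = ics_interval ics_simps

lemma rowmotion_eqI:
  assumes "ics n L U" "sweep n (ics n L) U = U'" "sweep n (\<lambda>S. ics n S U') L = L'"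
  shows "rowmotion (two_chain_product n) (rows L U) = rows L' U'"
  using rowmotion_rows[OF assms(1)] assms(2,3) by simp

lemma rowmotion_shift:
  assumes "1 \<le> c" "c \<le> d" "d < a" "a \<le> b" "b < n"
  shows "rowmotion (two_chain_product n) (rows {a..b} {c..d}) = rows {Suc a..Suc b} {Suc c..Suc d}"
proof (rule rowmotion_eqI)
  show "sweep n (ics n {a..b}) {c..d} = {Suc c..Suc d}"
    by (rule sweep_shift[OF ics_convex(2)]) (use assms in \<open>simp_all add: ics_box\<close>)
  show "sweep n (\<lambda>S. ics n S {Suc c..Suc d}) {a..b} = {Suc a..Suc b}"
    by (rule sweep_shift[OF ics_convex(1)]) (use assms in \<open>simp_all add: ics_box\<close>)
qed (use assms in \<open>simp add: ics_box\<close>)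

lemma rowmotion_lower:
  assumes "1 \<le> a" "a \<le> b" "b < n"
  shows "rowmotion (two_chain_product n) (rows {a..b} {}) = rows {Suc a..Suc b} {1..a}"
proof (rule rowmotion_eqI)
  show "sweep n (ics n {a..b}) {} = {1..a}"
    by (rule sweep_fill[OF ics_convex(2)]) (use assms in \<open>simp_all add: ics_box\<close>)
  show "sweep n (\<lambda>S. ics n S {1..a}) {a..b} = {Suc a..Suc b}"
    by (rule sweep_shift[OF ics_convex(1)]) (use assms in \<open>simp_all add: ics_box\<close>)
qed (use assms in \<open>simp add: ics_box\<close>)

lemma rowmotion_lower_top:
  assumes "1 \<le> a" "a \<le> n"
  shows "rowmotion (two_chain_product n) (rows {a..n} {}) = rows {} {1..a}"
proof (rule rowmotion_eqI)
  show "sweep n (ics n {a..n}) {} = {1..a}"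
    by (rule sweep_fill[OF ics_convex(2)]) (use assms in \<open>simp_all add: ics_box\<close>)
  \<comment> \<open>The case \<open>c = e\<close> of the shrinking sweep; its result
    \<open>{Suc a..a}\<close> is the empty set.\<close>
  have "sweep n (\<lambda>S. ics n S {1..a}) {a..n} = {Suc a..a}"
    by (rule sweep_shrink[OF ics_convex(1)]) (use assms in \<open>simp_all add: ics_box\<close>)
  then show "sweep n (\<lambda>S. ics n S {1..a}) {a..n} = {}" by simp
qed (use assms in \<open>simp add: ics_box\<close>)

lemma rowmotion_leave:
  assumes "1 \<le> c" "c \<le> d" "d < n"
  shows "rowmotion (two_chain_product n) (rows {Suc d..n} {c..d}) = rows {} {Suc c..Suc d}"
proof (rule rowmotion_eqI)
  show "sweep n (ics n {Suc d..n}) {c..d} = {Suc c..Suc d}"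
    by (rule sweep_shift[OF ics_convex(2)]) (use assms in \<open>simp_all add: ics_box\<close>)
  have "sweep n (\<lambda>S. ics n S {Suc c..Suc d}) {Suc d..n} = {Suc (Suc d)..Suc d}"
    by (rule sweep_shrink[OF ics_convex(1)]) (use assms in \<open>simp_all add: ics_box\<close>)
  then show "sweep n (\<lambda>S. ics n S {Suc c..Suc d}) {Suc d..n} = {}" by simp
qed (use assms in \<open>simp add: ics_box\<close>)

lemma rowmotion_upper:
  assumes "1 \<le> c" "c \<le> d" "d < n"
  shows "rowmotion (two_chain_product n) (rows {} {c..d}) = rows {Suc c..n} {Suc c..Suc d}"
proof (rule rowmotion_eqI)
  show "sweep n (ics n {}) {c..d} = {Suc c..Suc d}"
    by (rule sweep_shift[OF ics_convex(2)]) (use assms in \<open>simp_all add: ics_box\<close>)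
  show "sweep n (\<lambda>S. ics n S {Suc c..Suc d}) {} = {Suc c..n}"
    by (rule sweep_fill[OF ics_convex(1)]) (use assms in \<open>simp_all add: ics_box\<close>)
qed (use assms in \<open>simp add: ics_box\<close>)

lemma rowmotion_upper_top:
  assumes "e < n"
  shows "rowmotion (two_chain_product n) (rows {} {Suc e..n}) = rows {1..n} {1..e}"
proof (rule rowmotion_eqI)
  show "sweep n (ics n {}) {Suc e..n} = {1..e}"
    by (rule sweep_drop[OF ics_convex(2)]) (use assms in \<open>simp_all add: ics_box\<close>)
  show "sweep n (\<lambda>S. ics n S {1..e}) {} = {1..n}"
    by (rule sweep_fill[OF ics_convex(1)]) (use assms in \<open>auto simp: ics_box\<close>)
qed (use assms in \<open>simp add: ics_box\<close>)

text \<open>Without \<open>a\<close> the upper interval would start above the lower start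
  \<open>a\<close> and still reach past it, so the removal is blocked and the upper chain fills to
  the bottom. Its new top \<open>Suc d\<close> in turn stops the lower chain from shrinking
  further.\<close>

lemma rowmotion_stretch:
  assumes "1 \<le> a" "a \<le> d" "d < n"
  shows "rowmotion (two_chain_product n) (rows {a..n} {a..d}) = rows {Suc a..Suc d} {1..Suc d}"
proof (rule rowmotion_eqI)
  show "sweep n (ics n {a..n}) {a..d} = {1..Suc d}"
    by (rule sweep_stretch[OF ics_convex(2)]) (use assms in \<open>simp_all add: ics_box\<close>)
  show "sweep n (\<lambda>S. ics n S {1..Suc d}) {a..n} = {Suc a..Suc d}"
    by (rule sweep_shrink[OF ics_convex(1)]) (use assms in \<open>auto simp: ics_box\<close>)
qed (use assms in \<open>simp add: ics_box\<close>)

lemma rowmotion_clear: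
  assumes "1 \<le> a" "a \<le> b" "b < n"
  shows "rowmotion (two_chain_product n) (rows {a..b} {1..b}) = rows {Suc a..Suc b} {}"
proof (rule rowmotion_eqI)
  \<comment> \<open>The drop with \<open>e = 0\<close>: the upper interval cannot grow past the
    lower top \<open>b\<close>, and nothing is left below to regrow.\<close>
  have "sweep n (ics n {a..b}) {Suc 0..b} = {1..0}"
    by (rule sweep_drop[OF ics_convex(2)]) (use assms in \<open>simp_all add: ics_box\<close>)
  then show "sweep n (ics n {a..b}) {1..b} = {}" by simp
  show "sweep n (\<lambda>S. ics n S {}) {a..b} = {Suc a..Suc b}"
    by (rule sweep_shift[OF ics_convex(1)]) (use assms in \<open>simp_all add: ics_box\<close>)
qed (use assms in \<open>simp add: ics_box\<close>)

lemma rowmotion_both_top: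
  assumes "e \<le> g" "g < n"
  shows "rowmotion (two_chain_product n) (rows {Suc g..n} {Suc e..n}) = rows {1..g} {1..e}"
proof (rule rowmotion_eqI)
  show "sweep n (ics n {Suc g..n}) {Suc e..n} = {1..e}"
    by (rule sweep_drop[OF ics_convex(2)]) (use assms in \<open>simp_all add: ics_box\<close>)
  show "sweep n (\<lambda>S. ics n S {1..e}) {Suc g..n} = {1..g}"
    by (rule sweep_drop[OF ics_convex(1)]) (use assms in \<open>auto simp: ics_box\<close>)
qed (use assms in \<open>simp add: ics_box\<close>)

subsection \<open>Returns to the states containing the bottom element\<close>

text \<open>The endpoint \<open>t\<close> is included here and left free in \<open>returns\<close>,
  so that quiet stretches can be chained and then closed by a return.\<close>

definition quiet :: "nat \<Rightarrow> nat \<Rightarrow> (nat \<times> nat) set \<Rightarrow> (nat \<times> nat) set \<Rightarrow> bool" where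
  "quiet n t I J \<longleftrightarrow> (rowmotion (two_chain_product n) ^^ t) I = J \<and>
     (\<forall>j. 0 < j \<and> j \<le> t \<longrightarrow> (1, 1) \<notin> (rowmotion (two_chain_product n) ^^ j) I)"

definition returns :: "nat \<Rightarrow> nat \<Rightarrow> (nat \<times> nat) set \<Rightarrow> (nat \<times> nat) set \<Rightarrow> bool" where
  "returns n t I J \<longleftrightarrow> (rowmotion (two_chain_product n) ^^ t) I = J \<and> 0 < t \<and>
     (\<forall>j. 0 < j \<and> j < t \<longrightarrow> (1, 1) \<notin> (rowmotion (two_chain_product n) ^^ j) I)"

lemma quiet_0: "quiet n 0 I I"
  by (simp add: quiet_def)

lemma quiet_1: "rowmotion (two_chain_product n) I = J \<Longrightarrow> (1, 1) \<notin> J \<Longrightarrow> quiet n 1 I J"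
  by (auto simp: quiet_def le_Suc_eq)

lemma returns_1: "rowmotion (two_chain_product n) I = J \<Longrightarrow> returns n 1 I J"
  by (auto simp: returns_def)

lemma funpow_split: "i \<le> j \<Longrightarrow> (f ^^ j) x = (f ^^ (j - i)) ((f ^^ i) x)"
  by (metis comp_apply funpow_add le_add_diff_inverse2)

lemma quiet_trans [trans]:
  assumes "quiet n s I J" "quiet n t J K"
  shows "quiet n (s + t) I K"
  unfolding quiet_def
proof (intro conjI allI impI)
  show "(rowmotion (two_chain_product n) ^^ (s + t)) I = K"
    using assms by (simp add: quiet_def add.commute[of s] funpow_add)
  fix j assume j: "0 < j \<and> j \<le> s + t"
  show "(1, 1) \<notin> (rowmotion (two_chain_product n) ^^ j) I"
  proof (cases "j \<le> s")
    case True
    then show ?thesis using assms(1) j by (simp add: quiet_def)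
  next
    case False
    then show ?thesis using assms j by (simp add: quiet_def funpow_split[of s j])
  qed
qed

lemma quiet_returns [trans]:
  assumes "quiet n s I J" "returns n t J K"
  shows "returns n (s + t) I K"
  unfolding returns_def
proof (intro conjI allI impI)
  show "(rowmotion (two_chain_product n) ^^ (s + t)) I = K"
    using assms by (simp add: quiet_def returns_def add.commute[of s] funpow_add)
  show "0 < s + t" using assms by (simp add: returns_def)
  fix j assume j: "0 < j \<and> j < s + t"
  show "(1, 1) \<notin> (rowmotion (two_chain_product n) ^^ j) I"
  proof (cases "j \<le> s")
    case True
    then show ?thesis using assms(1) j by (simp add: quiet_def)
  next
    case False
    then show ?thesis using assms j by (simp add: quiet_def returns_def funpow_split[of s j])
  qed
qed

lemma quiet_shift:
  assumes "1 \<le> c" "c \<le> d" "d < a" "a \<le> b" "b + t \<le> n"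
  shows "quiet n t (rows {a..b} {c..d}) (rows {a + t..b + t} {c + t..d + t})"
  using assms(5)
proof (induction t)
  case (Suc t)
  have "quiet n 1 (rows {a + t..b + t} {c + t..d + t}) (rows {Suc (a + t)..Suc (b + t)} {Suc (c + t)..Suc (d + t)})"
    by (rule quiet_1, rule rowmotion_shift) (use assms Suc.prems in \<open>auto simp: mem_rows\<close>)
  from quiet_trans[OF Suc.IH this] Suc.prems show ?case by simp
qed (simp add: quiet_0)

text \<open>For \<open>t > 0\<close> the first step creates the upper interval
  \<open>{1..a}\<close>, \<open>t - 1\<close> shifts carry the lower one to \<open>n\<close>, and
  one more step expels it. For \<open>t = 0\<close> creation and expulsion happen in the same
  step.\<close>

lemma quiet_traverse:
  assumes "1 \<le> a" "a \<le> b" "b + t = n"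
  shows "quiet n (Suc t) (rows {a..b} {}) (rows {} {Suc t..t + a})"
proof (cases t)
  case 0
  then show ?thesis
    using quiet_1[OF rowmotion_lower_top, of a n] assms by (simp add: mem_rows)
next
  case (Suc s)
  have "quiet n 1 (rows {a..b} {}) (rows {Suc a..Suc b} {1..a})"
    by (rule quiet_1, rule rowmotion_lower) (use assms Suc in \<open>auto simp: mem_rows\<close>)
  also have "quiet n s (rows {Suc a..Suc b} {1..a}) (rows {Suc a + s..Suc b + s} {1 + s..a + s})"
    by (rule quiet_shift) (use assms Suc in auto)
  also have "rows {Suc a + s..Suc b + s} {1 + s..a + s} = rows {Suc (a + s)..n} {Suc s..a + s}"
    using assms Suc by simp
  also have "quiet n 1 (rows {Suc (a + s)..n} {Suc s..a + s}) (rows {} {Suc (Suc s)..Suc (a + s)})"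
    by (rule quiet_1, rule rowmotion_leave) (use assms Suc in \<open>auto simp: mem_rows\<close>)
  finally show ?thesis using Suc by (simp add: add.commute)
qed

lemma quiet_upper:
  assumes "1 \<le> c" "c \<le> d" "d < n"
  shows "quiet n 1 (rows {} {c..d}) (rows {Suc c..n} {Suc c..Suc d})"
  by (rule quiet_1, rule rowmotion_upper) (use assms in \<open>auto simp: mem_rows\<close>)

lemma quiet_upper_stretch:
  assumes "1 \<le> c" "c \<le> d" "Suc d < n"
  shows "quiet n 2 (rows {} {c..d}) (rows {Suc (Suc c)..Suc (Suc d)} {1..Suc (Suc d)})"
proof -
  have "quiet n 1 (rows {} {c..d}) (rows {Suc c..n} {Suc c..Suc d})"
    using assms by (intro quiet_upper) auto
  also have "quiet n 1 (rows {Suc c..n} {Suc c..Suc d}) (rows {Suc (Suc c)..Suc (Suc d)} {1..Suc (Suc d)})"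
    by (rule quiet_1, rule rowmotion_stretch) (use assms in \<open>auto simp: mem_rows\<close>)
  finally show ?thesis by (simp add: numeral_2_eq_2)
qed

text \<open>The lower chain is filled from just above \<open>c\<close> to \<open>n\<close>, next the
  upper interval is stretched to the bottom while the lower one is cut to size, and finally the
  upper chain is cleared. Each step uses up one free place above \<open>d\<close>.\<close>

lemma quiet_bounce:
  assumes "1 \<le> c" "c \<le> d" "d + 3 \<le> n"
  shows "quiet n 3 (rows {} {c..d}) (rows {c + 3..d + 3} {})"
proof -
  have "quiet n 2 (rows {} {c..d}) (rows {Suc (Suc c)..Suc (Suc d)} {1..Suc (Suc d)})"
    using assms by (intro quiet_upper_stretch) auto
  also have "quiet n 1 (rows {Suc (Suc c)..Suc (Suc d)} {1..Suc (Suc d)}) (rows {Suc (Suc (Suc c))..Suc (Suc (Suc d))} {})"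
    by (rule quiet_1, rule rowmotion_clear) (use assms in \<open>auto simp: mem_rows\<close>)
  finally show ?thesis by (simp add: numeral_3_eq_3)
qed

text \<open>The section. The state \<open>Full 0\<close> would be \<open>Low n\<close>, and \<open>Full n\<close> would be \<open>Diag n\<close>;
  \<open>Low 1\<close> and \<open>Full (n - 1)\<close> lie on a different orbit, that of \<open>{(1, 1)}\<close>.\<close>

datatype entry = Low nat | Diag nat | Full nat

fun state :: "nat \<Rightarrow> entry \<Rightarrow> (nat \<times> nat) set" where
  "state n (Low k) = rows {1..k} {}"
| "state n (Diag k) = rows {1..k} {1..k}"
| "state n (Full m) = rows {1..n} {1..m}"

text \<open>With exactly two free places the bounce is cut short: the stretched upper chain is full,
  so the next step empties it and the lower chain regrows from below its old start.\<close>

lemma returns_Low: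
  assumes "1 \<le> c" "c + 2 \<le> n"
  shows "returns n 3 (rows {} {c..n - 2}) (state n (Low (Suc c)))"
proof -
  have *: "Suc (Suc (n - 2)) = n" using assms by simp
  have "quiet n 2 (rows {} {c..n - 2}) (rows {Suc (Suc c)..n} {1..n})"
    using quiet_upper_stretch[of c "n - 2" n] assms unfolding * by simp
  also have "returns n 1 (rows {Suc (Suc c)..n} {1..n}) (state n (Low (Suc c)))"
    using rowmotion_both_top[of 0 "Suc c" n] assms by (intro returns_1) simp
  finally show ?thesis by simp
qed

lemma returns_Diagiag:
  assumes "1 \<le> c" "c < n"
  shows "returns n 2 (rows {} {c..n - 1}) (state n (Diag c))"
proof -
  have *: "Suc (n - 1) = n" using assms by simp
  have "quiet n 1 (rows {} {c..n - 1}) (rows {Suc c..n} {Suc c..n})"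
    using quiet_upper[of c "n - 1" n] assms unfolding * by simp
  also have "returns n 1 (rows {Suc c..n} {Suc c..n}) (state n (Diag c))"
    using rowmotion_both_top[of c c n] assms by (intro returns_1) simp
  finally show ?thesis by (simp add: numeral_2_eq_2)
qed

lemma returns_Full: "m < n \<Longrightarrow> returns n 1 (rows {} {Suc m..n}) (state n (Full m))"
  by (rule returns_1) (simp add: rowmotion_upper_top)

text \<open>In all three families the first crossing ends at \<open>n - k + 1\<close>, where
  \<open>k\<close> is the parameter, so there is room for a bounce exactly from 4 on. The value at
  \<open>Full 0\<close> is that of \<open>Low n\<close>.\<close>

fun next_entry :: "nat \<Rightarrow> entry \<Rightarrow> entry" where
  "next_entry n (Low k) = (if 4 \<le> k then Full (k - 4) else if k = 3 then Low (n - 1) else Diag (n - 1))"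
| "next_entry n (Diag k) =
    (if 4 \<le> k then Diag (k - 3) else if k = 3 then Low (n - 2) else if k = 2 then Diag (n - 2) else Full (n - 2))"
| "next_entry n (Full m) =
    (if 4 \<le> m then Low (m - 2) else if m = 3 then Low (n - 3) else if m = 2 then Diag (n - 3)
     else if m = 1 then Full (n - 3) else Full (n - 4))"

text \<open>On a route with a bounce the lengths of the two crossings add up to a constant, so the
  time does not depend on the parameter. The shorter routes all take \<open>n + 1\<close> steps,
  except \<open>Full 0\<close>, which bounces as \<open>Low n\<close> does.\<close>

fun return_time :: "nat \<Rightarrow> entry \<Rightarrow> nat" where
  "return_time n (Low k) = (if 4 \<le> k then n + 2 else n + 1)"
| "return_time n (Diag k) = (if 4 \<le> k then n + 3 else n + 1)"
| "return_time n (Full m) = (if 4 \<le> m then n + 4 else if m = 0 then n + 2 else n + 1)"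

fun entry_of :: "nat \<Rightarrow> entry \<Rightarrow> bool" where
  "entry_of n (Low k) \<longleftrightarrow> 2 \<le> k \<and> k < n"
| "entry_of n (Diag k) \<longleftrightarrow> 1 \<le> k \<and> k < n"
| "entry_of n (Full m) \<longleftrightarrow> m + 2 \<le> n"

lemma returns_from_Low:
  assumes "2 \<le> k" "k \<le> n"
  shows "returns n (return_time n (Low k)) (rows {1..k} {}) (state n (next_entry n (Low k)))"
proof -
  have "quiet n (Suc (n - k)) (rows {1..k} {}) (rows {} {Suc (n - k)..n - k + 1})"
    using assms by (intro quiet_traverse) auto
  then have start: "quiet n (Suc (n - k)) (rows {1..k} {}) (rows {} {Suc (n - k)..Suc (n - k)})"
    by simp
  consider "4 \<le> k" | "k = 3" | "k = 2" using assms by linarith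
  then show ?thesis
  proof cases
    case 1
    note start
    also have "quiet n 3 (rows {} {Suc (n - k)..Suc (n - k)}) (rows {Suc (n - k) + 3..Suc (n - k) + 3} {})"
      using assms 1 by (intro quiet_bounce) auto
    also have "quiet n (Suc (k - 4)) (rows {Suc (n - k) + 3..Suc (n - k) + 3} {})
        (rows {} {Suc (k - 4)..(k - 4) + (Suc (n - k) + 3)})"
      using assms 1 by (intro quiet_traverse) auto
    also have "rows {} {Suc (k - 4)..(k - 4) + (Suc (n - k) + 3)} = rows {} {Suc (k - 4)..n}"
      by (intro arg_cong2[where f = "\<lambda>x y. rows {} {x..y}"]) (use assms 1 in linarith)+
    also have "returns n 1 (rows {} {Suc (k - 4)..n}) (state n (Full (k - 4)))"
      using assms 1 by (intro returns_Full) auto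
    also have "Suc (n - k) + 3 + Suc (k - 4) + 1 = n + 2"
      using assms 1 by simp
    finally show ?thesis using 1 by (simp only: next_entry.simps return_time.simps if_True)
  next
    case 2
    note start
    also have "rows {} {Suc (n - k)..Suc (n - k)} = rows {} {n - 2..n - 2}"
      by (intro arg_cong2[where f = "\<lambda>x y. rows {} {x..y}"]) (use assms 2 in linarith)+
    also have "returns n 3 (rows {} {n - 2..n - 2}) (state n (Low (Suc (n - 2))))"
      using assms 2 by (intro returns_Low) auto
    also have "Suc (n - 2) = n - 1" using assms 2 by simp
    also have "Suc (n - k) + 3 = n + 1" using assms 2 by simp
    finally show ?thesis using 2 by (simp del: state.simps)
  next
    case 3
    note start
    also have "rows {} {Suc (n - k)..Suc (n - k)} = rows {} {n - 1..n - 1}"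
      by (intro arg_cong2[where f = "\<lambda>x y. rows {} {x..y}"]) (use assms 3 in linarith)+
    also have "returns n 2 (rows {} {n - 1..n - 1}) (state n (Diag (n - 1)))"
      using assms 3 by (intro returns_Diagiag) auto
    also have "Suc (n - k) + 2 = n + 1" using assms 3 by simp
    finally show ?thesis using 3 by (simp del: state.simps)
  qed
qed

lemma returns_from_Diag:
  assumes "1 \<le> k" "k < n"
  shows "returns n (return_time n (Diag k)) (rows {1..k} {1..k}) (state n (next_entry n (Diag k)))"
proof -
  have "quiet n 1 (rows {1..k} {1..k}) (rows {Suc 1..Suc k} {})"
    by (rule quiet_1, rule rowmotion_clear) (use assms in \<open>auto simp: mem_rows\<close>)
  also have "quiet n (Suc (n - Suc k)) (rows {Suc 1..Suc k} {}) (rows {} {Suc (n - Suc k)..n - Suc k + Suc 1})"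
    using assms by (intro quiet_traverse) auto
  also have "rows {} {Suc (n - Suc k)..n - Suc k + Suc 1} = rows {} {n - k..n - k + 1}"
      by (intro arg_cong2[where f = "\<lambda>x y. rows {} {x..y}"]) (use assms in linarith)+
  also have "1 + Suc (n - Suc k) = Suc (n - k)"
    using assms by simp
  finally have start: "quiet n (Suc (n - k)) (rows {1..k} {1..k}) (rows {} {n - k..n - k + 1})" .
  consider "4 \<le> k" | "k = 3" | "k = 2" | "k = 1" using assms by linarith
  then show ?thesis
  proof cases
    case 1
    note start
    also have "quiet n 3 (rows {} {n - k..n - k + 1}) (rows {n - k + 3..n - k + 1 + 3} {})"
      using assms 1 by (intro quiet_bounce) auto
    also have "quiet n (Suc (k - 4)) (rows {n - k + 3..n - k + 1 + 3} {})
        (rows {} {Suc (k - 4)..(k - 4) + (n - k + 3)})"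
      using assms 1 by (intro quiet_traverse) auto
    also have "rows {} {Suc (k - 4)..(k - 4) + (n - k + 3)} = rows {} {k - 3..n - 1}"
      by (intro arg_cong2[where f = "\<lambda>x y. rows {} {x..y}"]) (use assms 1 in linarith)+
    also have "returns n 2 (rows {} {k - 3..n - 1}) (state n (Diag (k - 3)))"
      using assms 1 by (intro returns_Diagiag) auto
    also have "Suc (n - k) + 3 + Suc (k - 4) + 2 = n + 3"
      using assms 1 by simp
    finally show ?thesis using 1 by (simp only: next_entry.simps return_time.simps if_True)
  next
    case 2
    note start
    also have "rows {} {n - k..n - k + 1} = rows {} {n - 3..n - 2}"
      by (intro arg_cong2[where f = "\<lambda>x y. rows {} {x..y}"]) (use assms 2 in linarith)+
    also have "returns n 3 (rows {} {n - 3..n - 2}) (state n (Low (Suc (n - 3))))"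
      using assms 2 by (intro returns_Low) auto
    also have "Suc (n - 3) = n - 2" using assms 2 by simp
    also have "Suc (n - k) + 3 = n + 1" using assms 2 by simp
    finally show ?thesis using 2 by (simp del: state.simps)
  next
    case 3
    note start
    also have "rows {} {n - k..n - k + 1} = rows {} {n - 2..n - 1}"
      by (intro arg_cong2[where f = "\<lambda>x y. rows {} {x..y}"]) (use assms 3 in linarith)+
    also have "returns n 2 (rows {} {n - 2..n - 1}) (state n (Diag (n - 2)))"
      using assms 3 by (intro returns_Diagiag) auto
    also have "Suc (n - k) + 2 = n + 1" using assms 3 by simp
    finally show ?thesis using 3 by (simp del: state.simps)
  next
    case 4
    note start
    also have "rows {} {n - k..n - k + 1} = rows {} {Suc (n - 2)..n}"
      by (intro arg_cong2[where f = "\<lambda>x y. rows {} {x..y}"]) (use assms 4 in linarith)+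
    also have "returns n 1 (rows {} {Suc (n - 2)..n}) (state n (Full (n - 2)))"
      using assms 4 by (intro returns_Full) auto
    also have "Suc (n - k) + 1 = n + 1" using assms 4 by simp
    finally show ?thesis using 4 by (simp del: state.simps)
  qed
qed

lemma returns_from_Full:
  assumes "1 \<le> m" "m + 2 \<le> n"
  shows "returns n (return_time n (Full m)) (rows {1..n} {1..m}) (state n (next_entry n (Full m)))"
proof -
  have "quiet n 1 (rows {1..n} {1..m}) (rows {Suc 1..Suc m} {1..Suc m})"
    by (rule quiet_1, rule rowmotion_stretch) (use assms in \<open>auto simp: mem_rows\<close>)
  also have "quiet n 1 (rows {Suc 1..Suc m} {1..Suc m}) (rows {Suc (Suc 1)..Suc (Suc m)} {})"
    by (rule quiet_1, rule rowmotion_clear) (use assms in \<open>auto simp: mem_rows\<close>)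
  also have "quiet n (Suc (n - Suc (Suc m))) (rows {Suc (Suc 1)..Suc (Suc m)} {})
      (rows {} {Suc (n - Suc (Suc m))..n - Suc (Suc m) + Suc (Suc 1)})"
    using assms by (intro quiet_traverse) auto
  also have "rows {} {Suc (n - Suc (Suc m))..n - Suc (Suc m) + Suc (Suc 1)} = rows {} {n - m - 1..n - m + 1}"
      by (intro arg_cong2[where f = "\<lambda>x y. rows {} {x..y}"]) (use assms in linarith)+
  also have "1 + 1 + Suc (n - Suc (Suc m)) = n - m + 1"
    using assms by simp
  finally have start: "quiet n (n - m + 1) (rows {1..n} {1..m}) (rows {} {n - m - 1..n - m + 1})" .
  consider "4 \<le> m" | "m = 3" | "m = 2" | "m = 1" using assms by linarith
  then show ?thesis
  proof cases
    case 1
    note start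
    also have "quiet n 3 (rows {} {n - m - 1..n - m + 1}) (rows {n - m - 1 + 3..n - m + 1 + 3} {})"
      using assms 1 by (intro quiet_bounce) auto
    also have "quiet n (Suc (m - 4)) (rows {n - m - 1 + 3..n - m + 1 + 3} {})
        (rows {} {Suc (m - 4)..(m - 4) + (n - m - 1 + 3)})"
      using assms 1 by (intro quiet_traverse) auto
    also have "rows {} {Suc (m - 4)..(m - 4) + (n - m - 1 + 3)} = rows {} {m - 3..n - 2}"
      by (intro arg_cong2[where f = "\<lambda>x y. rows {} {x..y}"]) (use assms 1 in linarith)+
    also have "returns n 3 (rows {} {m - 3..n - 2}) (state n (Low (Suc (m - 3))))"
      using assms 1 by (intro returns_Low) auto
    also have "Suc (m - 3) = m - 2" using assms 1 by simp
    also have "n - m + 1 + 3 + Suc (m - 4) + 3 = n + 4"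
      using assms 1 by simp
    finally show ?thesis using 1 by (simp only: next_entry.simps return_time.simps if_True)
  next
    case 2
    note start
    also have "rows {} {n - m - 1..n - m + 1} = rows {} {n - 4..n - 2}"
      by (intro arg_cong2[where f = "\<lambda>x y. rows {} {x..y}"]) (use assms 2 in linarith)+
    also have "returns n 3 (rows {} {n - 4..n - 2}) (state n (Low (Suc (n - 4))))"
      using assms 2 by (intro returns_Low) auto
    also have "Suc (n - 4) = n - 3" using assms 2 by simp
    also have "n - m + 1 + 3 = n + 1" using assms 2 by simp
    finally show ?thesis using 2 by (simp del: state.simps)
  next
    case 3
    note start
    also have "rows {} {n - m - 1..n - m + 1} = rows {} {n - 3..n - 1}"
      by (intro arg_cong2[where f = "\<lambda>x y. rows {} {x..y}"]) (use assms 3 in linarith)+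
    also have "returns n 2 (rows {} {n - 3..n - 1}) (state n (Diag (n - 3)))"
      using assms 3 by (intro returns_Diagiag) auto
    also have "n - m + 1 + 2 = n + 1" using assms 3 by simp
    finally show ?thesis using 3 by (simp del: state.simps)
  next
    case 4
    note start
    also have "rows {} {n - m - 1..n - m + 1} = rows {} {Suc (n - 3)..n}"
      by (intro arg_cong2[where f = "\<lambda>x y. rows {} {x..y}"]) (use assms 4 in linarith)+
    also have "returns n 1 (rows {} {Suc (n - 3)..n}) (state n (Full (n - 3)))"
      using assms 4 by (intro returns_Full) auto
    also have "n - m + 1 + 1 = n + 1" using assms 4 by simp
    finally show ?thesis using 4 by (simp del: state.simps)
  qed
qed

lemma returns_state:
  assumes "5 \<le> n" "entry_of n s"
  shows "returns n (return_time n s) (state n s) (state n (next_entry n s))"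
proof (cases s)
  case (Low k)
  then show ?thesis using returns_from_Low[of k n] assms by (simp del: next_entry.simps return_time.simps)
next
  case (Diag k)
  then show ?thesis using returns_from_Diag[of k n] assms by (simp del: next_entry.simps return_time.simps)
next
  case (Full m)
  show ?thesis
  proof (cases "m = 0")
    case True
    \<comment> \<open>\<open>Full 0\<close> and \<open>Low n\<close> denote the same set; this is
      why \<open>returns_from_Low\<close> admits \<open>k = n\<close> although
      \<open>entry_of\<close> does not.\<close>
    then show ?thesis using returns_from_Low[of n n] assms Full by simp
  next
    case False
    then show ?thesis using returns_from_Full[of m n] assms Full by (simp del: next_entry.simps return_time.simps)
  qed
qed

subsection \<open>Orbits and first returns\<close>

lemma orbit_eqI: "x \<in> orbit f x \<Longrightarrow> y \<in> orbit f x \<Longrightarrow> orbit f y = orbit f x"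
  by (blast intro: orbit_trans orbit_swap)

text \<open>Cancelling \<open>i\<close> steps by injectivity puts \<open>st s\<close>, a point of
  \<open>S\<close>, on the path of \<open>st s'\<close> at time \<open>j - i < t\<close>; as that
  path is outside \<open>S\<close> strictly between 0 and \<open>t\<close>, the time is 0.\<close>

lemma first_return_unique:
  assumes bij: "bij_betw f A A" and "st s \<in> A" "st s' \<in> A" "st s \<in> S"
    and quiet: "\<And>k. 0 < k \<Longrightarrow> k < t \<Longrightarrow> (f ^^ k) (st s') \<notin> S"
    and "(f ^^ i) (st s) = (f ^^ j) (st s')" "i \<le> j" "j < t"
  shows "i = j \<and> st s = st s'"
proof -
  have "(f ^^ j) (st s') = (f ^^ i) ((f ^^ (j - i)) (st s'))"
    using \<open>i \<le> j\<close> by (metis comp_apply funpow_add le_add_diff_inverse)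
  moreover have "(f ^^ (j - i)) (st s') \<in> A"
    using bij_betw_funpow[OF bij] \<open>st s' \<in> A\<close> bij_betwE by blast
  ultimately have eq: "st s = (f ^^ (j - i)) (st s')"
    using assms(2,6) inj_onD[OF bij_betw_imp_inj_on[OF bij_betw_funpow[OF bij, of i]]] by metis
  then have "j - i = 0"
    using quiet[of "j - i"] \<open>st s \<in> S\<close> \<open>j < t\<close> by fastforce
  then show ?thesis using eq \<open>i \<le> j\<close> by simp
qed

text \<open>The path pieces of length \<open>\<tau> s\<close> cover the orbit because
  \<open>f\<close> takes the last point of a piece to the start of another. By
  \<open>first_return_unique\<close> they are disjoint and repeat no point, so their lengths add up
  to the cardinality.\<close>

lemma orbit_first_return:
  fixes f :: "'a \<Rightarrow> 'a" and st :: "'b \<Rightarrow> 'a"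
  assumes bij: "bij_betw f A A" and C: "finite C" "C \<noteq> {}" "inj_on st C"
    and st: "\<And>s. s \<in> C \<Longrightarrow> st s \<in> A \<and> st s \<in> S \<and> st s \<in> orbit f (st s) \<and> orbit f (st s) = Q"
    and ret: "\<And>s. s \<in> C \<Longrightarrow> T s \<in> C \<and> (f ^^ \<tau> s) (st s) = st (T s) \<and> 0 < \<tau> s"
    and quiet: "\<And>s k. s \<in> C \<Longrightarrow> 0 < k \<Longrightarrow> k < \<tau> s \<Longrightarrow> (f ^^ k) (st s) \<notin> S"
  shows "card Q = sum \<tau> C" and "Q \<inter> S = st ` C"
proof -
  let ?path = "\<lambda>s. (\<lambda>j. (f ^^ j) (st s)) ` {..<\<tau> s}"
  have step: "f x \<in> (\<Union>s\<in>C. ?path s)" if "x \<in> (\<Union>s\<in>C. ?path s)" for x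
  proof -
    obtain s j where x: "s \<in> C" "j < \<tau> s" "x = (f ^^ j) (st s)" using \<open>x \<in> _\<close> by auto
    show ?thesis
    proof (cases "Suc j = \<tau> s")
      case True
      then have "f x = (f ^^ 0) (st (T s))" using ret[OF x(1)] x(3) by (metis comp_apply funpow.simps(1,2) id_apply)
      then show ?thesis using ret[OF x(1)] ret[of "T s"] by blast
    next
      case False
      then have "Suc j < \<tau> s" "f x = (f ^^ Suc j) (st s)" using x by simp_all
      then show ?thesis using x(1) by blast
    qed
  qed
  obtain s0 where s0: "s0 \<in> C" using C(2) by blast
  have start: "st s0 \<in> (\<Union>s\<in>C. ?path s)" using s0 ret[OF s0] by (force intro: image_eqI[where x = 0])
  have "x \<in> (\<Union>s\<in>C. ?path s)" if "x \<in> orbit f (st s0)" for x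
    using that by induct (rule step, (rule start | assumption))+
  moreover have "?path s \<subseteq> Q" if "s \<in> C" for s
    using st[OF that] funpow_in_orbit[of "st s" f "st s"] by auto
  ultimately have Q: "Q = (\<Union>s\<in>C. ?path s)" using st[OF s0] by blast
  have uniq: "i = j \<and> s = s'"
    if "s \<in> C" "s' \<in> C" "i < \<tau> s" "j < \<tau> s'" "(f ^^ i) (st s) = (f ^^ j) (st s')" for s s' i j
  proof -
    have "i = j \<and> st s = st s'"
    proof (cases "i \<le> j")
      case True
      then show ?thesis
        using that st quiet by (intro first_return_unique[OF bij, of _ _ _ S "\<tau> s'"]) auto
    next
      case False
      then have "j = i \<and> st s' = st s"
        using that st quiet by (intro first_return_unique[OF bij, of _ _ _ S "\<tau> s"]) auto
      then show ?thesis by simp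
    qed
    then show ?thesis using that C(3) by (auto dest: inj_onD)
  qed
  have "card Q = (\<Sum>s\<in>C. card (?path s))"
    unfolding Q using C(1) uniq by (intro card_UN_disjoint) auto
  also have "\<dots> = sum \<tau> C"
  proof (rule sum.cong)
    fix s assume "s \<in> C"
    then have "inj_on (\<lambda>j. (f ^^ j) (st s)) {..<\<tau> s}" using uniq by (auto intro: inj_onI)
    then show "card (?path s) = \<tau> s" by (simp add: card_image)
  qed simp
  finally show "card Q = sum \<tau> C" .
  show "Q \<inter> S = st ` C"
  proof
    show "Q \<inter> S \<subseteq> st ` C"
    proof
      fix x assume "x \<in> Q \<inter> S"
      then obtain s j where x: "s \<in> C" "j < \<tau> s" "x = (f ^^ j) (st s)" "x \<in> S" unfolding Q by auto
      then have "j = 0" using quiet[of s j] by auto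
      then show "x \<in> st ` C" using x by simp
    qed
    show "st ` C \<subseteq> Q \<inter> S" using st by auto
  qed
qed

subsection \<open>Classes of section states\<close>

text \<open>The offset 2 puts \<open>Full m\<close> and \<open>Low (m - 2)\<close> into one class;
  \<open>Low k\<close> and \<open>Full (k - 4)\<close> then agree too, since 2 and -4 are congruent
  modulo 6.\<close>

fun class_of :: "entry \<Rightarrow> nat" where
  "class_of (Low k) = (k + 2) mod 6"
| "class_of (Diag k) = 6 + k mod 3"
| "class_of (Full m) = m mod 6"

fun index :: "entry \<Rightarrow> nat" where
  "index (Low k) = k" | "index (Diag k) = k" | "index (Full k) = k"

text \<open>The entry of least index in each of the nine classes, where the descent inside the class
  stops.\<close>

definition last_entry :: "nat \<Rightarrow> entry" where
  "last_entry c = (if c \<le> 3 then Full c else if c = 4 then Low 2 else if c = 5 then Low 3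
     else if c = 6 then Diag 3 else if c = 7 then Diag 1 else Diag 2)"

definition link :: "nat \<Rightarrow> nat \<Rightarrow> nat" where
  "link n c = class_of (next_entry n (last_entry c))"

definition entries :: "nat \<Rightarrow> nat set \<Rightarrow> entry set" where
  "entries n K = {s. entry_of n s \<and> class_of s \<in> K}"

lemma entry_of_next: "5 \<le> n \<Longrightarrow> entry_of n s \<Longrightarrow> entry_of n (next_entry n s)"
  by (cases s) auto

lemma entry_of_last: "5 \<le> n \<Longrightarrow> entry_of n (last_entry c)"
  by (auto simp: last_entry_def)

lemma class_of_last: "c < 9 \<Longrightarrow> class_of (last_entry c) = c"
  by (auto simp: last_entry_def)

lemma last_or_descends:
  assumes "entry_of n s"
  shows "s = last_entry (class_of s) \<or>
    class_of (next_entry n s) = class_of s \<and> index (next_entry n s) < index s"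
proof (cases s)
  case (Low k)
  consider "4 \<le> k" | "k = 2" | "k = 3" using assms Low by fastforce
  then show ?thesis
  proof cases
    case 1
    then obtain j where "k = j + 4" by (metis add.commute le_Suc_ex)
    then show ?thesis using Low by (simp add: mod_add_right_eq)
  qed (use Low in \<open>simp_all add: last_entry_def\<close>)
next
  case (Diag k)
  consider "4 \<le> k" | "k = 1" | "k = 2" | "k = 3" using assms Diag by fastforce
  then show ?thesis
  proof cases
    case 1
    then have "(k - 3) mod 3 = k mod 3" by (simp add: le_mod_geq)
    then show ?thesis using Diag 1 by simp
  qed (use Diag in \<open>simp_all add: last_entry_def\<close>)
next
  case (Full k)
  consider "4 \<le> k" | "k = 0" | "k = 1" | "k = 2" | "k = 3" by linarith
  then show ?thesis
  proof cases
    case 1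
    then have "Suc (Suc (k - 2)) = k" by simp
    then show ?thesis using Full 1 by simp
  qed (use Full in \<open>simp_all add: last_entry_def\<close>)
qed

text \<open>Six values are \<open>n\<close> shifted by -4, -3, -1, 1, 0, -2, distinct modulo 6; the
  other three are shifts by -3, -1, -2, distinct modulo 3. So \<open>link n\<close> permutes the
  nine classes.\<close>

lemma link_values:
  assumes "5 \<le> n"
  shows "link n 0 = (n - 4) mod 6" "link n 1 = (n - 3) mod 6" "link n 2 = 6 + (n - 3) mod 3"
    "link n 3 = (n - 1) mod 6" "link n 4 = 6 + (n - 1) mod 3" "link n 5 = (n + 1) mod 6"
    "link n 6 = n mod 6" "link n 7 = (n - 2) mod 6" "link n 8 = 6 + (n - 2) mod 3"
proof -
  have "Suc (Suc (n - 3)) = n - 1" "Suc (Suc (n - 2)) = n" using assms by simp_all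
  then show "link n 0 = (n - 4) mod 6" "link n 1 = (n - 3) mod 6" "link n 2 = 6 + (n - 3) mod 3"
    "link n 3 = (n - 1) mod 6" "link n 4 = 6 + (n - 1) mod 3" "link n 5 = (n + 1) mod 6"
    "link n 6 = n mod 6" "link n 7 = (n - 2) mod 6" "link n 8 = 6 + (n - 2) mod 3"
    using assms by (simp_all add: link_def last_entry_def)
qed

definition class_orbit :: "nat \<Rightarrow> nat \<Rightarrow> (nat \<times> nat) set set" where
  "class_orbit n c = orbit (rowmotion (two_chain_product n)) (state n (last_entry c))"

lemma state_in_ics:
  "entry_of n s \<Longrightarrow> state n s \<in> interval_closed_sets (two_chain_product n)"
  unfolding ics_def[symmetric] by (cases s) (simp_all add: ics_def[symmetric] ics_box)

lemma in_orbit: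
  "I \<in> interval_closed_sets (two_chain_product n) \<Longrightarrow> I \<in> orbit (rowmotion (two_chain_product n)) I"
  by (rule in_orbit_rowmotion) (auto simp: two_chain_product_def)

lemma returns_orbit:
  assumes "returns n t I J" "I \<in> interval_closed_sets (two_chain_product n)"
  shows "orbit (rowmotion (two_chain_product n)) J = orbit (rowmotion (two_chain_product n)) I"
  using assms by (intro orbit_eqI in_orbit) (auto simp: returns_def orbit_altdef)

text \<open>Following returns never leaves the orbit, and within a class it lowers the index until
  the last entry is met.\<close>

lemma orbit_class:
  assumes "5 \<le> n" "entry_of n s"
  shows "orbit (rowmotion (two_chain_product n)) (state n s) = class_orbit n (class_of s)"
  using assms(2)
proof (induction "index s" arbitrary: s rule: less_induct)
  case less
  from last_or_descends[OF less.prems] show ?case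
  proof
    assume "s = last_entry (class_of s)"
    then show ?thesis by (metis class_orbit_def)
  next
    assume *: "class_of (next_entry n s) = class_of s \<and> index (next_entry n s) < index s"
    then show ?thesis
      using less.hyps[of "next_entry n s"] entry_of_next[OF assms(1) less.prems]
        returns_orbit[OF returns_state[OF assms(1) less.prems] state_in_ics[OF less.prems]] by simp
  qed
qed

lemma class_orbit_link:
  assumes "5 \<le> n"
  shows "class_orbit n (link n c) = class_orbit n c"
  using orbit_class[OF assms entry_of_next[OF assms entry_of_last[OF assms]], of c]
    returns_orbit[OF returns_state[OF assms entry_of_last[OF assms]] state_in_ics[OF entry_of_last[OF assms]], of c]
  by (simp add: link_def class_orbit_def)

lemma finite_entries: "finite (entries n K)"
proof (rule finite_subset)
  show "entries n K \<subseteq> Low ` {..<n} \<union> Diag ` {..<n} \<union> Full ` {..n}"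
  proof
    fix s assume "s \<in> entries n K"
    then show "s \<in> Low ` {..<n} \<union> Diag ` {..<n} \<union> Full ` {..n}"
      by (cases s) (auto simp: entries_def)
  qed
qed simp

lemma rows_eq_iff: "rows L U = rows L' U' \<longleftrightarrow> L = L' \<and> U = U'"
proof
  assume eq: "rows L U = rows L' U'"
  have "k \<in> L \<longleftrightarrow> k \<in> L'" "k \<in> U \<longleftrightarrow> k \<in> U'" for k
    using mem_rows[of 1 k L U] mem_rows[of 1 k L' U'] mem_rows[of 2 k L U] mem_rows[of 2 k L' U'] eq
    by simp_all
  then show "L = L' \<and> U = U'" by blast
qed simp

lemma inj_on_state: "inj_on (state n) (Collect (entry_of n))"
proof (rule inj_onI)
  have eq: "{1..i} = {1..j} \<longleftrightarrow> i = j" for i j :: nat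
    by (cases i; cases j) (auto simp: Icc_eq_Icc)
  fix s s' assume "s \<in> Collect (entry_of n)" "s' \<in> Collect (entry_of n)" "state n s = state n s'"
  then show "s = s'"
    using eq[of _ 0] eq[of 0] by (cases s; cases s') (auto simp: rows_eq_iff eq simp del: One_nat_def)
qed

lemma one_in_state: "entry_of n s \<Longrightarrow> (1, 1) \<in> state n s"
  by (cases s) (auto simp: mem_rows)

definition linked :: "nat \<Rightarrow> nat set \<Rightarrow> (nat \<times> nat) set set \<Rightarrow> bool" where
  "linked n K Q \<longleftrightarrow> K \<noteq> {} \<and> K \<subseteq> {..<9} \<and> (\<forall>c\<in>K. link n c \<in> K \<and> class_orbit n c = Q)"

text \<open>A return either stays in its class or follows \<open>link\<close>, so closure of
  \<open>K\<close> keeps the return map inside \<open>entries n K\<close>. The exact intersection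
  with the section is what later separates orbits and excludes singletons.\<close>

lemma linked_orbit:
  assumes n: "5 \<le> n" and "linked n K Q"
  shows "card Q = sum (return_time n) (entries n K)"
    and "Q \<inter> {I. (1, 1) \<in> I} = state n ` entries n K"
proof -
  let ?P = "two_chain_product n" and ?C = "entries n K"
  have ne: "?C \<noteq> {}"
  proof -
    obtain c where "c \<in> K" "c < 9" using assms(2) by (auto simp: linked_def)
    then have "last_entry c \<in> ?C" using entry_of_last[OF n] by (simp add: entries_def class_of_last)
    then show ?thesis by blast
  qed
  have inj: "inj_on (state n) ?C"
    by (rule inj_on_subset[OF inj_on_state]) (auto simp: entries_def)
  have *: "state n s \<in> interval_closed_sets ?P \<and> state n s \<in> {I. (1, 1) \<in> I} \<and>
      state n s \<in> orbit (rowmotion ?P) (state n s) \<and> orbit (rowmotion ?P) (state n s) = Q" if "s \<in> ?C" for s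
    using that assms(2) state_in_ics[of n s] in_orbit[of "state n s" n] one_in_state[of n s] orbit_class[OF n, of s]
    by (auto simp: entries_def linked_def)
  have closed: "next_entry n s \<in> ?C" if "s \<in> ?C" for s
  proof -
    have s: "entry_of n s" "class_of s \<in> K" using that by (auto simp: entries_def)
    from last_or_descends[OF s(1)] have "class_of (next_entry n s) \<in> {class_of s, link n (class_of s)}"
      unfolding link_def by force
    then show ?thesis using s assms(2) entry_of_next[OF n s(1)] by (auto simp: entries_def linked_def)
  qed
  have ret: "returns n (return_time n s) (state n s) (state n (next_entry n s))" if "s \<in> ?C" for s
    using returns_state[OF n] that by (simp add: entries_def)
  note first = orbit_first_return[where S = "{I. (1, 1) \<in> I}" and T = "next_entry n" and \<tau> = "return_time n",
      OF bij_betw_rowmotion[of ?P] finite_entries ne inj *]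
  show "card Q = sum (return_time n) ?C"
    by (rule first) (use closed ret in \<open>auto simp: returns_def\<close>)
  show "Q \<inter> {I. (1, 1) \<in> I} = state n ` ?C"
    by (rule first) (use closed ret in \<open>auto simp: returns_def\<close>)
qed

subsection \<open>Orbit sizes\<close>

text \<open>\<open>(b + (m - 1) - c) div m\<close> counts the numbers below \<open>b\<close>
  congruent to \<open>c\<close> modulo \<open>m\<close>; passing to \<open>Suc b\<close> adds one
  exactly when \<open>b\<close> itself is congruent to \<open>c\<close>.\<close>

lemma div_Suc_shift:
  fixes b c m :: nat
  assumes "0 < m" "c < m"
  shows "(Suc b + (m - 1) - c) div m = (b + (m - 1) - c) div m + (if b mod m = c then 1 else 0)"
proof -
  have "Suc b + (m - 1) - c = Suc (b + (m - 1) - c)" using assms by simp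
  moreover have "Suc (b + (m - 1) - c) mod m = 0 \<longleftrightarrow> b mod m = c"
  proof -
    have "Suc (b + (m - 1) - c) = b + (m - c)" using assms by simp
    moreover have "(b + (m - c)) mod m = (b mod m + (m - c)) mod m" by (simp add: mod_add_left_eq)
    moreover have "(b mod m + (m - c)) mod m = 0 \<longleftrightarrow> b mod m = c"
    proof -
      have "b mod m < m" "b mod m - c < m" using assms by (simp_all add: less_imp_diff_less)
      then show ?thesis
        using assms by (cases "b mod m < c"; cases "b mod m = c") (auto simp: le_mod_geq)
    qed
    ultimately show ?thesis by simp
  qed
  ultimately show ?thesis by (simp add: div_Suc)
qed

lemma less_6_cases: "c < (6::nat) \<Longrightarrow> c = 0 \<or> c = 1 \<or> c = 2 \<or> c = 3 \<or> c = 4 \<or> c = 5"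
  by linarith

lemma lessThan_4: "{..<4::nat} = {0, 1, 2, 3}"
  by auto

lemma mult_add_if: "x * (y + (if P then 1 else 0)) = x * y + (if P then x else 0)" for x y :: nat
  by simp

text \<open>Every \<open>Full m\<close> is charged \<open>n + 4\<close>. This is 2 too much for
  \<open>m = 0\<close> and 3 too much for \<open>m = 1, 2, 3\<close>, and a residue meets at most
  one of these. From 4 on the charge is exact, hence the base of the induction.\<close>

lemma sum_return_time_Full:
  assumes "4 \<le> b" "c < 6"
  shows "(\<Sum>m<b. if m mod 6 = c then return_time n (Full m) else 0) + (if c = 0 then 2 else if c \<le> 3 then 3 else 0)
    = (n + 4) * ((b + 5 - c) div 6)"
  using assms(1)
proof (induction rule: dec_induct)
  case base
  show ?case unfolding lessThan_4 using less_6_cases[OF assms(2)] by (elim disjE) simp_all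
next
  case (step b)
  have shift: "(Suc b + 5 - c) div 6 = (b + 5 - c) div 6 + (if b mod 6 = c then 1 else 0)"
    using div_Suc_shift[of 6 c b] assms(2) by simp
  have "return_time n (Full b) = n + 4" using step.hyps by simp
  then show ?case
    unfolding sum.lessThan_Suc shift mult_add_if step.IH[symmetric] by (simp only: ac_simps)
qed

text \<open>The quotient counts all \<open>j < b + 2\<close> with \<open>j mod 6 = c\<close>. For
  \<open>c \<le> 3\<close> the number \<open>j = c\<close> does not come from a
  \<open>k \<ge> 2\<close> and is taken off; for \<open>c = 4, 5\<close> the entries
  \<open>Low 2\<close> and \<open>Low 3\<close> return one step early.\<close>

lemma sum_return_time_Low:
  assumes "4 \<le> b" "c < 6"
  shows "(\<Sum>k<b. if 2 \<le> k \<and> (k + 2) mod 6 = c then return_time n (Low k) else 0) + (if 4 \<le> c then 1 else 0)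
    = (n + 2) * ((b + 7 - c) div 6 - (if c \<le> 3 then 1 else 0))"
  using assms(1)
proof (induction rule: dec_induct)
  case base
  show ?case unfolding lessThan_4 using less_6_cases[OF assms(2)] by (elim disjE) simp_all
next
  case (step b)
  \<comment> \<open>A positive quotient makes the subtraction of 1 exact, so it commutes with adding
    the new term.\<close>
  have one: "1 \<le> (b + 7 - c) div 6" using step.hyps assms(2) by (simp add: div_greater_zero_iff Suc_le_eq)
  have "Suc (b + 2) + (6 - 1) - c = Suc b + 7 - c" "b + 2 + (6 - 1) - c = b + 7 - c" by simp_all
  then have "(Suc b + 7 - c) div 6 = (b + 7 - c) div 6 + (if (b + 2) mod 6 = c then 1 else 0)"
    using div_Suc_shift[of 6 c "b + 2"] assms(2) by (simp only: zero_less_numeral)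
  then have shift: "(Suc b + 7 - c) div 6 - (if c \<le> 3 then 1 else 0) =
      (b + 7 - c) div 6 - (if c \<le> 3 then 1 else 0) + (if (b + 2) mod 6 = c then 1 else 0)"
    using one by (cases "c \<le> 3") simp_all
  have "2 \<le> b" "return_time n (Low b) = n + 2" using step.hyps by simp_all
  then show ?case
    unfolding sum.lessThan_Suc shift mult_add_if step.IH[symmetric] by (simp only: ac_simps simp_thms)
qed

text \<open>Each residue contains exactly one of 1, 2, 3, which returns two steps before
  \<open>n + 3\<close>. For \<open>d = 0\<close> the quotient also counts \<open>k = 0\<close>,
  which is taken off.\<close>

lemma sum_return_time_Diag:
  assumes "4 \<le> b" "d < 3"
  shows "(\<Sum>k<b. if 1 \<le> k \<and> k mod 3 = d then return_time n (Diag k) else 0) + 2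
    = (n + 3) * ((b + 2 - d) div 3 - (if d = 0 then 1 else 0))"
  using assms(1)
proof (induction rule: dec_induct)
  case base
  have "d = 0 \<or> d = 1 \<or> d = 2" using assms(2) by linarith
  then show ?case unfolding lessThan_4 by (elim disjE) simp_all
next
  case (step b)
  have one: "1 \<le> (b + 2 - d) div 3" using step.hyps assms(2) by (simp add: div_greater_zero_iff Suc_le_eq)
  have "Suc b + (3 - 1) - d = Suc b + 2 - d" "b + (3 - 1) - d = b + 2 - d" by simp_all
  then have "(Suc b + 2 - d) div 3 = (b + 2 - d) div 3 + (if b mod 3 = d then 1 else 0)"
    using div_Suc_shift[of 3 d b] assms(2) by (simp only: zero_less_numeral)
  then have shift: "(Suc b + 2 - d) div 3 - (if d = 0 then 1 else 0) =
      (b + 2 - d) div 3 - (if d = 0 then 1 else 0) + (if b mod 3 = d then 1 else 0)"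
    using one by (cases "d = 0") simp_all
  have "1 \<le> b" "return_time n (Diag b) = n + 3" using step.hyps by simp_all
  then show ?case
    unfolding sum.lessThan_Suc shift mult_add_if step.IH[symmetric] by (simp only: ac_simps simp_thms)
qed

definition weight :: "nat \<Rightarrow> nat \<Rightarrow> nat" where
  "weight n c = sum (return_time n) (entries n {c})"

lemma sum_entries:
  assumes "finite K"
  shows "sum (return_time n) (entries n K) = sum (weight n) K"
proof -
  have "entries n K = (\<Union>c\<in>K. entries n {c})" by (auto simp: entries_def)
  moreover have "sum (return_time n) (\<Union>c\<in>K. entries n {c}) = (\<Sum>c\<in>K. sum (return_time n) (entries n {c}))"
    using assms by (rule sum.UNION_disjoint) (simp add: finite_entries, auto simp: entries_def)
  ultimately show ?thesis by (simp add: weight_def)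
qed

lemma weight_less_6:
  assumes "5 \<le> n" "c < 6"
  shows "weight n c + (if c = 0 then 2 else if c \<le> 3 then 3 else 1) =
    (n + 4) * ((n + 4 - c) div 6) + (n + 2) * ((n + 7 - c) div 6 - (if c \<le> 3 then 1 else 0))"
proof -
  let ?F = "{m \<in> {..<n - 1}. m mod 6 = c}" and ?E = "{k \<in> {..<n}. 2 \<le> k \<and> (k + 2) mod 6 = c}"
  have "entries n {c} = Full ` ?F \<union> Low ` ?E"
  proof (intro set_eqI)
    fix s
    show "s \<in> entries n {c} \<longleftrightarrow> s \<in> Full ` ?F \<union> Low ` ?E"
      using assms by (cases s) (auto simp: entries_def)
  qed
  then have "weight n c = sum (return_time n) (Full ` ?F \<union> Low ` ?E)"
    by (simp only: weight_def)
  also have "\<dots> = sum (return_time n) (Full ` ?F) + sum (return_time n) (Low ` ?E)"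
    by (rule sum.union_disjoint) auto
  also have "\<dots> = (\<Sum>m\<in>?F. return_time n (Full m)) + (\<Sum>k\<in>?E. return_time n (Low k))"
    by (simp add: sum.reindex inj_on_def del: return_time.simps)
  also have "\<dots> = (\<Sum>m<n - 1. if m mod 6 = c then return_time n (Full m) else 0) +
      (\<Sum>k<n. if 2 \<le> k \<and> (k + 2) mod 6 = c then return_time n (Low k) else 0)"
    by (simp only: sum.inter_filter finite_lessThan)
  finally have w: "weight n c = \<dots>" .
  have "n - 1 + 5 - c = n + 4 - c" using assms by simp
  moreover have "4 \<le> n - 1" using assms by simp
  note sum_return_time_Full[OF this assms(2), of n]
  ultimately have Full: "(\<Sum>m<n - 1. if m mod 6 = c then return_time n (Full m) else 0) +
      (if c = 0 then 2 else if c \<le> 3 then 3 else 0) = (n + 4) * ((n + 4 - c) div 6)"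
    by (simp only:)
  have Low: "(\<Sum>k<n. if 2 \<le> k \<and> (k + 2) mod 6 = c then return_time n (Low k) else 0) + (if 4 \<le> c then 1 else 0)
    = (n + 2) * ((n + 7 - c) div 6 - (if c \<le> 3 then 1 else 0))"
    by (rule sum_return_time_Low) (use assms in linarith)+
  have "(if c = 0 then 2 else if c \<le> 3 then 3 else 1) =
      (if c = 0 then 2 else if c \<le> 3 then 3 else 0) + (if 4 \<le> c then 1 else 0 :: nat)"
    by auto
  then show ?thesis unfolding w Full[symmetric] Low[symmetric] by (simp only: ac_simps)
qed

lemma weight_Diag:
  assumes "5 \<le> n" "d < 3"
  shows "weight n (6 + d) + 2 = (n + 3) * ((n + 2 - d) div 3 - (if d = 0 then 1 else 0))"
proof -
  let ?D = "{k \<in> {..<n}. 1 \<le> k \<and> k mod 3 = d}"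
  have "entries n {6 + d} = Diag ` ?D"
  proof (intro set_eqI)
    fix s
    have "k mod 6 \<noteq> 6 + d" for k using mod_less_divisor[of 6 k] by linarith
    then show "s \<in> entries n {6 + d} \<longleftrightarrow> s \<in> Diag ` ?D"
      by (cases s) (auto simp: entries_def simp del: mod_less_divisor add_2_eq_Suc')
  qed
  then have "weight n (6 + d) = (\<Sum>k\<in>?D. return_time n (Diag k))"
    by (simp add: weight_def sum.reindex inj_on_def del: return_time.simps)
  also have "\<dots> = (\<Sum>k<n. if 1 \<le> k \<and> k mod 3 = d then return_time n (Diag k) else 0)"
    by (simp only: sum.inter_filter finite_lessThan)
  finally have w: "weight n (6 + d) = \<dots>" .
  show ?thesis unfolding w by (rule sum_return_time_Diag) (use assms in linarith)+
qed

subsection \<open>Cycles of classes\<close>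

lemma last_state_in_orbit:
  assumes "5 \<le> n" "linked n K Q" "c \<in> K"
  shows "state n (last_entry c) \<in> Q"
  using assms in_orbit[OF state_in_ics[OF entry_of_last[OF assms(1), of c]]]
  by (auto simp: linked_def class_orbit_def)

text \<open>Orbits that meet coincide. The last state of a class in \<open>K\<close> would then be a
  section state of \<open>Q'\<close>, hence an entry of \<open>K'\<close>, and injectivity of
  \<open>state\<close> would put its class into both sets.\<close>

lemma linked_disjoint:
  assumes n: "5 \<le> n" and K: "linked n K Q" "linked n K' Q'" "K \<inter> K' = {}"
  shows "Q \<inter> Q' = {}"
proof (rule ccontr)
  assume "Q \<inter> Q' \<noteq> {}"
  then obtain I where I: "I \<in> Q" "I \<in> Q'" by blast
  obtain c c' where c: "c \<in> K" "c' \<in> K'" using K by (auto simp: linked_def)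
  then have Q: "Q = class_orbit n c" "Q' = class_orbit n c'" using K by (auto simp: linked_def)
  have self: "state n (last_entry d) \<in> class_orbit n d" for d
    unfolding class_orbit_def by (intro in_orbit state_in_ics entry_of_last n)
  have "Q = Q'"
    using I orbit_eqI[OF self[unfolded class_orbit_def]] unfolding Q class_orbit_def by metis
  then have "state n (last_entry c) \<in> state n ` entries n K'"
    using last_state_in_orbit[OF n K(1) c(1)] one_in_state[OF entry_of_last[OF n], of c]
      linked_orbit(2)[OF n K(2)] by blast
  then obtain s where s: "s \<in> entries n K'" "state n (last_entry c) = state n s" by blast
  then have "last_entry c = s"
    using inj_on_state[of n] entry_of_last[OF n, of c] by (auto simp: entries_def dest: inj_onD)
  then have "class_of (last_entry c) \<in> K'" using s by (simp add: entries_def)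
  moreover have "class_of (last_entry c) = c" using c K by (intro class_of_last) (auto simp: linked_def)
  ultimately show False using c K(3) by auto
qed

lemma linked_card:
  assumes "5 \<le> n" "linked n K Q"
  shows "card Q = sum (weight n) K"
proof -
  have "finite K" using assms(2) finite_subset[of K "{..<9}"] by (auto simp: linked_def)
  then show ?thesis using linked_orbit(1)[OF assms] sum_entries by simp
qed

lemma linked_finite: "5 \<le> n \<Longrightarrow> linked n K Q \<Longrightarrow> finite Q"
  using finite_orbit[OF in_orbit[OF state_in_ics[OF entry_of_last]]]
  by (auto simp: linked_def class_orbit_def)

lemma linked_nonempty: "linked n K Q \<Longrightarrow> Q \<noteq> {}"
  by (auto simp: linked_def class_orbit_def orbit_nonempty)

lemma linked_in_rowmotion_orbits:
  "5 \<le> n \<Longrightarrow> linked n K Q \<Longrightarrow> Q \<in> rowmotion_orbits (two_chain_product n)"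
  using state_in_ics[OF entry_of_last] unfolding linked_def class_orbit_def rowmotion_orbits_def
  by blast

lemma in_orbit_if_returns:
  assumes "returns n t I (state n s)" "I \<in> interval_closed_sets (two_chain_product n)"
    and "5 \<le> n" "entry_of n s" "linked n K Q" "class_of s \<in> K"
  shows "I \<in> Q"
  using in_orbit[OF assms(2)] returns_orbit[OF assms(1,2)] orbit_class[OF assms(3,4)] assms(5,6)
  by (simp add: linked_def)

lemma orbit_in_ics:
  assumes "I \<in> interval_closed_sets P" "J \<in> orbit (rowmotion P) I"
  shows "J \<in> interval_closed_sets P"
  using assms(2) bij_betwE[OF bij_betw_rowmotion[of P]] assms(1) by induct auto

section \<open>Locating singletons and the exceptional pair\<close>

lemma returns_lower_singleton:
  assumes "1 \<le> i" "i \<le> n"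
  shows "returns n (Suc (n - i) + 1) (rows {i..i} {}) (state n (Full (n - i)))"
proof -
  have "quiet n (Suc (n - i)) (rows {i..i} {}) (rows {} {Suc (n - i)..n - i + i})"
    using assms by (intro quiet_traverse) auto
  also have "n - i + i = n" using assms by simp
  also have "returns n 1 (rows {} {Suc (n - i)..n}) (state n (Full (n - i)))"
    using assms by (intro returns_Full) auto
  finally show ?thesis .
qed

text \<open>The first return is at \<open>Full (n - i)\<close>, whose class is
  \<open>(n - i) mod 6\<close>. For \<open>i = 1\<close> this would be \<open>Full (n - 1)\<close>,
  which is outside the section.\<close>

lemma lower_singleton_in_orbit:
  assumes n: "5 \<le> n" and i: "2 \<le> i" "i \<le> n" and K: "linked n K Q" "(n - i) mod 6 \<in> K"
  shows "{(1, i)} \<in> Q"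
proof -
  have "returns n (Suc (n - i) + 1) (rows {i..i} {}) (state n (Full (n - i)))"
    using i by (intro returns_lower_singleton) auto
  moreover have "rows {i..i} {} \<in> interval_closed_sets (two_chain_product n)"
    unfolding ics_def[symmetric] ics_box using i by simp
  ultimately have "rows {i..i} {} \<in> Q"
    by (rule in_orbit_if_returns) (use n i K in simp_all)
  then show ?thesis by (simp add: rows_def)
qed

lemma mod_6_diff:
  fixes i n :: nat
  assumes "i \<le> n"
  shows "(n - i) mod 6 = (n mod 6 + 6 - i mod 6) mod 6"
proof -
  obtain a b c d where n: "n = 6 * a + b" "b = n mod 6" and i: "i = 6 * c + d" "d = i mod 6" "d < 6"
    by (metis mod_less_divisor mult_div_mod_eq zero_less_numeral)
  obtain k where k: "n = i + k" using assms le_Suc_ex by blast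
  obtain e where e: "6 = d + e" using i(3) less_imp_le_nat le_Suc_ex by blast
  have "k + 6 * (c + 1) = b + e + 6 * a"
    using k n(1) i(1) e by simp
  then have "n - i + 6 * (c + 1) = b + 6 - d + 6 * a"
    using k e by simp
  then show ?thesis unfolding n(2)[symmetric] i(2)[symmetric] by (metis mod_mult_self2)
qed

lemma lower_singletons_subset:
  assumes "5 \<le> n" "linked n K Q" "2 \<le> m \<or> m = 1 \<and> 1 \<notin> S"
    and "\<And>a. a \<in> S \<Longrightarrow> (n mod 6 + 6 - a) mod 6 \<in> K"
  shows "lower_singletons m n S \<subseteq> Q"
proof
  fix x assume "x \<in> lower_singletons m n S"
  then obtain i where i: "x = {(1, i)}" "m \<le> i" "i \<le> n" "i mod 6 \<in> S"
    by (auto simp: lower_singletons_def)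
  have "2 \<le> i"
  proof (rule ccontr)
    assume "\<not> 2 \<le> i"
    then have "i = 1" "m = 1" using i assms(3) by auto
    then show False using i assms(3) by simp
  qed
  then show "x \<in> Q"
    using lower_singleton_in_orbit[OF assms(1) _ i(3) assms(2)] i(1) assms(4)[OF i(4)] mod_6_diff[OF i(3)]
    by simp
qed

text \<open>One crossing leaves the upper interval \<open>{2..n - 1}\<close>, one place short of the
  top, which returns at \<open>Diag 2\<close>.\<close>

lemma class_8_pair_in_orbit:
  assumes n: "5 \<le> n" and K: "linked n K Q" "8 \<in> K"
  shows "{(1, n - 2), (1, n - 1)} \<in> Q"
proof -
  have "quiet n (Suc 1) (rows {n - 2..n - 1} {}) (rows {} {Suc 1..1 + (n - 2)})"
    using n by (intro quiet_traverse) auto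
  also have "1 + (n - 2) = n - 1" using n by simp
  also have "returns n 2 (rows {} {Suc 1..n - 1}) (state n (Diag (Suc 1)))"
    using n by (intro returns_Diagiag) auto
  finally have "returns n (Suc 1 + 2) (rows {n - 2..n - 1} {}) (state n (Diag (Suc 1)))" .
  moreover have "rows {n - 2..n - 1} {} \<in> interval_closed_sets (two_chain_product n)"
    unfolding ics_def[symmetric] ics_box using n by (intro impI conjI) linarith+
  ultimately have "rows {n - 2..n - 1} {} \<in> Q"
    by (rule in_orbit_if_returns) (use n K in simp_all)
  moreover have "{n - 2..n - 1} = {n - 2, n - 1}" using n by auto
  ultimately show ?thesis by (simp add: rows_def)
qed

lemma class_of_eq_8: "class_of s = 8 \<Longrightarrow> \<exists>k. s = Diag k \<and> k mod 3 = 2"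
proof (cases s)
  case (Low k)
  have "(k + 2) mod 6 < (6::nat)" by simp
  then show "class_of s = 8 \<Longrightarrow> ?thesis" using Low by (simp del: mod_less_divisor)
next
  case (Full k)
  have "k mod 6 < (6::nat)" by simp
  then show "class_of s = 8 \<Longrightarrow> ?thesis" using Full by (simp del: mod_less_divisor)
qed simp

text \<open>The states containing \<open>(1, 1)\<close> in this orbit are all of the form
  \<open>Diag k\<close> with \<open>k < n\<close>. \<open>Full (n - 1)\<close> is listed apart
  because it is not an entry, yet some singletons lead to it.\<close>

lemma not_returns_from_class_8:
  assumes n: "5 \<le> n" and Q: "linked n {8} Q" and "I \<in> Q" "returns n t I (state n s)"
    and s: "s = Full (n - 1) \<or> entry_of n s \<and> class_of s \<noteq> 8"
  shows False
proof -
  have Q8: "Q = class_orbit n 8" using Q by (simp add: linked_def)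
  have "(rowmotion (two_chain_product n) ^^ t) I \<in> Q"
    using assms(3) unfolding Q8 class_orbit_def by (rule funpow_in_orbit)
  then have "state n s \<in> Q" using assms(4) by (simp add: returns_def)
  moreover have "(1, 1) \<in> state n s" using s one_in_state[of n s] n by (auto simp: mem_rows)
  ultimately obtain s' where s': "s' \<in> entries n {8}" "state n s = state n s'"
    using linked_orbit(2)[OF n Q] by blast
  then obtain k where k: "s' = Diag k" "k < n" using class_of_eq_8[of s'] by (auto simp: entries_def)
  from s show False
  proof
    assume "s = Full (n - 1)"
    then have "{1..n} = {1..k}" using s'(2) k by (simp add: rows_eq_iff)
    then have "n \<in> {1..k}" using n by auto
    then show False using k(2) by simp
  next
    assume "entry_of n s \<and> class_of s \<noteq> 8"
    then show False using s' inj_onD[OF inj_on_state[of n], of s s'] by (auto simp: entries_def)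
  qed
qed

text \<open>A lower singleton first returns at a \<open>Full\<close> state; an upper one bounces
  into a lower one or, near the top, returns directly at \<open>Low (n - 1)\<close>,
  \<open>Diag (n - 1)\<close> or \<open>Full (n - 1)\<close>. None of these is in class 8.\<close>

lemma no_singleton:
  assumes n: "5 \<le> n" "n mod 3 = 1" and Q: "linked n {8} Q"
  shows "{x} \<notin> Q"
proof
  assume xQ: "{x} \<in> Q"
  note False_if = not_returns_from_class_8[OF n(1) Q xQ]
  have Full_class: "class_of (Full m) \<noteq> 8" for m using class_of_eq_8[of "Full m"] by blast
  obtain r i where x: "x = (r, i)" by fastforce
  have "{x} \<in> interval_closed_sets (two_chain_product n)"
    using xQ Q orbit_in_ics[OF state_in_ics[OF entry_of_last[OF n(1)]]]
    by (auto simp: linked_def class_orbit_def)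
  then have "x \<in> two_chain_product n" by (auto simp: interval_closed_sets_def)
  then have i: "1 \<le> i" "i \<le> n" and r: "r = 1 \<or> r = 2" using x by (auto simp: two_chain_product_def)
  show False
  proof (cases "r = 1")
    case True
    then have "{x} = rows {i..i} {}" using x by (auto simp: rows_def)
    moreover have "returns n (Suc (n - i) + 1) (rows {i..i} {}) (state n (Full (n - i)))"
      using i by (intro returns_lower_singleton)
    moreover have "Full (n - i) = Full (n - 1) \<or> entry_of n (Full (n - i))" using i by auto
    ultimately show ?thesis using Full_class False_if by metis
  next
    case False
    then have x: "{x} = rows {} {i..i}" using x r by (auto simp: rows_def)
    consider "i + 3 \<le> n" | "i = n - 2" | "i = n - 1" | "i = n" using i by linarith
    then show ?thesis
    proof cases
      case 1
      have "quiet n 3 (rows {} {i..i}) (rows {i + 3..i + 3} {})"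
        using i 1 by (intro quiet_bounce) auto
      also have "returns n (Suc (n - (i + 3)) + 1) (rows {i + 3..i + 3} {}) (state n (Full (n - (i + 3))))"
        using i 1 by (intro returns_lower_singleton) auto
      finally show ?thesis unfolding x[symmetric]
        by (rule False_if) (use Full_class 1 in auto)
    next
      case 2
      have "returns n 3 (rows {} {i..n - 2}) (state n (Low (Suc i)))"
        using i n 2 by (intro returns_Low) auto
      then have "returns n 3 {x} (state n (Low (Suc i)))" using x 2 by simp
      then show ?thesis
        by (rule False_if) (use 2 n class_of_eq_8[of "Low (Suc i)"] in auto)
    next
      case 3
      have "returns n 2 (rows {} {i..n - 1}) (state n (Diag i))"
        using i n 3 by (intro returns_Diagiag) auto
      then have "returns n 2 {x} (state n (Diag i))" using x 3 by simp
      \<comment> \<open>Here \<open>n mod 3 = 1\<close> enters: it puts \<open>Diag (n - 1)\<close>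
        into class 6.\<close>
      moreover have "i mod 3 = 0" using 3 n by presburger
      then have "Diag i = Full (n - 1) \<or> entry_of n (Diag i) \<and> class_of (Diag i) \<noteq> 8" using 3 n by simp
      ultimately show ?thesis by (rule False_if)
    next
      case 4
      have "returns n 1 (rows {} {Suc (n - 1)..n}) (state n (Full (n - 1)))"
        using n by (intro returns_Full) auto
      then have "returns n 1 {x} (state n (Full (n - 1)))" using x 4 n by simp
      then show ?thesis by (rule False_if) simp
    qed
  qed
qed

section \<open>Assembling the orbits for each residue\<close>

lemma linked_cycle:
  assumes n: "5 \<le> n" and cs: "cs \<noteq> []" "\<forall>c\<in>set cs. c < 9" "map (link n) cs = rotate1 cs"
  shows "linked n (set cs) (class_orbit n (hd cs))"
proof -
  have link: "link n (cs ! i) = cs ! (Suc i mod length cs)" if "i < length cs" for i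
    using that cs(3) by (metis length_map nth_map nth_rotate1)
  have orb: "class_orbit n (cs ! i) = class_orbit n (hd cs)" if "i < length cs" for i
    using that
  proof (induction i)
    case 0
    then show ?case using cs(1) by (simp add: hd_conv_nth)
  next
    case (Suc i)
    then show ?case using link[of i] class_orbit_link[OF n, of "cs ! i"] by simp
  qed
  have "link n c \<in> set cs \<and> class_orbit n c = class_orbit n (hd cs)" if "c \<in> set cs" for c
  proof -
    obtain i where "i < length cs" "c = cs ! i" using \<open>c \<in> set cs\<close> by (metis in_set_conv_nth)
    then show ?thesis using link[of i] orb[of i] cs(1) by simp
  qed
  moreover have "set cs \<subseteq> {..<9}" using cs(2) by auto
  ultimately show ?thesis unfolding linked_def using cs(1) by blast
qed

lemma linked_orbits:
  assumes n: "5 \<le> n" and "list_all2 (linked n) Ks Os" "sorted_wrt (\<lambda>K K'. K \<inter> K' = {}) Ks"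
  shows "set Os \<subseteq> rowmotion_orbits (two_chain_product n) \<and> distinct Os \<and>
    card (\<Union> (set Os)) = sum_list (map card Os)"
  using assms(2,3)
proof (induction rule: list_all2_induct)
  case (Cons K Ks Q Os)
  have ex: "\<exists>K'\<in>set Ks. linked n K' Q'" if "Q' \<in> set Os" for Q'
    using Cons.hyps(2) that by (metis in_set_conv_nth list_all2_conv_all_nth)
  have disj: "Q \<inter> Q' = {}" if Q': "Q' \<in> set Os" for Q'
  proof -
    obtain K' where "K' \<in> set Ks" "linked n K' Q'" using ex[OF Q'] by blast
    moreover from this have "K \<inter> K' = {}" using Cons.prems by simp
    ultimately show ?thesis using linked_disjoint[OF n Cons.hyps(1)] by blast
  qed
  have "finite Q'" if "Q' \<in> set Os" for Q'
    using ex[OF that] linked_finite[OF n] by blast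
  then have "finite (\<Union> (set Os))" by blast
  moreover have "finite Q" "Q \<noteq> {}" "Q \<in> rowmotion_orbits (two_chain_product n)"
    using Cons.hyps(1) linked_finite[OF n] linked_nonempty linked_in_rowmotion_orbits[OF n] by blast+
  moreover have "Q \<inter> \<Union> (set Os) = {}" using disj by blast
  moreover have "Q \<notin> set Os" using disj \<open>Q \<noteq> {}\<close> by blast
  moreover have "set Os \<subseteq> rowmotion_orbits (two_chain_product n) \<and> distinct Os \<and>
    card (\<Union> (set Os)) = sum_list (map card Os)"
    using Cons.IH Cons.prems by simp
  ultimately show ?case by (simp add: card_Un_disjoint)
qed simp

text \<open>Splitting off \<open>6 * q\<close> leaves quotients of numerals once \<open>r\<close> is
  known, so each weight becomes an explicit polynomial in \<open>n\<close> and
  \<open>q\<close>.\<close>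

lemma real_weight:
  assumes n: "n = 6 * q + r" "5 \<le> r" and c: "c < 6"
  shows "real (weight n c) =
    (real n + 4) * (real q + real ((r + 4 - c) div 6)) +
    (real n + 2) * (real q + real ((r + 7 - c) div 6 - (if c \<le> 3 then 1 else 0))) -
    (if c = 0 then 2 else if c \<le> 3 then 3 else 1)"
proof -
  have "n + 4 - c = r + 4 - c + 6 * q" "n + 7 - c = r + 7 - c + 6 * q"
    using assms by simp_all
  then have d: "(n + 4 - c) div 6 = q + (r + 4 - c) div 6" "(n + 7 - c) div 6 = q + (r + 7 - c) div 6"
    by simp_all
  have "1 \<le> (r + 7 - c) div 6" using assms by (simp add: div_greater_zero_iff Suc_le_eq)
  then have "(n + 7 - c) div 6 - (if c \<le> 3 then 1 else 0) =
      q + ((r + 7 - c) div 6 - (if c \<le> 3 then 1 else 0))"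
    unfolding d by simp
  from weight_less_6[of n c, unfolded this d(1)]
  have "real (weight n c + (if c = 0 then 2 else if c \<le> 3 then 3 else 1)) =
      real ((n + 4) * (q + (r + 4 - c) div 6) +
        (n + 2) * (q + ((r + 7 - c) div 6 - (if c \<le> 3 then 1 else 0))))"
    using assms by (intro arg_cong[where f = real]) linarith
  moreover have "real (if c = 0 then 2 else if c \<le> 3 then 3 else 1) =
      (if c = 0 then 2 else if c \<le> 3 then 3 else 1)" by simp
  ultimately show ?thesis by (simp only: of_nat_add of_nat_mult of_nat_numeral)
qed

lemma real_weight_Diag:
  assumes n: "n = 6 * q + r" "5 \<le> r" and d: "d < 3"
  shows "real (weight n (6 + d)) =
    (real n + 3) * (2 * real q + real ((r + 2 - d) div 3 - (if d = 0 then 1 else 0))) - 2"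
proof -
  have "n + 2 - d = r + 2 - d + 3 * (2 * q)" using assms by simp
  then have *: "(n + 2 - d) div 3 = 2 * q + (r + 2 - d) div 3"
    by (simp only: div_mult_self2)
  have "1 \<le> (r + 2 - d) div 3" using assms by (simp add: div_greater_zero_iff Suc_le_eq)
  then have "(n + 2 - d) div 3 - (if d = 0 then 1 else 0) =
      2 * q + ((r + 2 - d) div 3 - (if d = 0 then 1 else 0))"
    unfolding * by simp
  from weight_Diag[of n d, unfolded this]
  have "real (weight n (6 + d) + 2) =
      real ((n + 3) * (2 * q + ((r + 2 - d) div 3 - (if d = 0 then 1 else 0))))"
    using assms by (intro arg_cong[where f = real]) linarith
  then show ?thesis by (simp only: of_nat_add of_nat_mult of_nat_numeral)
qed

lemma link_residue:
  assumes n: "n = 6 * q + r" "5 \<le> r"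
  shows "link n 0 = (r - 4) mod 6" "link n 1 = (r - 3) mod 6" "link n 2 = 6 + (r - 3) mod 3"
    "link n 3 = (r - 1) mod 6" "link n 4 = 6 + (r - 1) mod 3" "link n 5 = (r + 1) mod 6"
    "link n 6 = r mod 6" "link n 7 = (r - 2) mod 6" "link n 8 = 6 + (r - 2) mod 3"
proof -
  have m6: "(n - i) mod 6 = (r - i) mod 6" and m3: "(n - i) mod 3 = (r - i) mod 3" if "i < 5" for i
  proof -
    have a: "n - i = r - i + 6 * q" and b: "n - i = r - i + 3 * (2 * q)" using n that by simp_all
    show "(n - i) mod 6 = (r - i) mod 6" unfolding a by (rule mod_mult_self2)
    show "(n - i) mod 3 = (r - i) mod 3" unfolding b by (rule mod_mult_self2)
  qed
  have p6: "(n + i) mod 6 = (r + i) mod 6" for i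
  proof -
    have "n + i = r + i + 6 * q" using n by simp
    then show ?thesis by (simp only: mod_mult_self2)
  qed
  have "5 \<le> n" using n by simp
  note link = link_values[OF this]
  show "link n 0 = (r - 4) mod 6" using m6[of 4] link(1) by simp
  show "link n 1 = (r - 3) mod 6" using m6[of 3] link(2) by simp
  show "link n 2 = 6 + (r - 3) mod 3" using m3[of 3] link(3) by simp
  show "link n 3 = (r - 1) mod 6" using m6[of 1] link(4) by simp
  show "link n 4 = 6 + (r - 1) mod 3" using m3[of 1] link(5) by simp
  show "link n 5 = (r + 1) mod 6" using p6[of 1] link(6) by simp
  show "link n 6 = r mod 6" using p6[of 0] link(7) by simp
  show "link n 7 = (r - 2) mod 6" using m6[of 2] link(8) by simp
  show "link n 8 = 6 + (r - 2) mod 3" using m3[of 2] link(9) by simp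
qed

theorem theorem3p26:
  fixes n :: nat
  assumes "n \<ge> 5"
  shows "\<exists>Os. set Os \<subseteq> rowmotion_orbits (two_chain_product n) \<and> distinct Os \<and>
    real (card (\<Union> (set Os))) = 3 * real n ^ 2 + 5 * real n - 30 \<and>
    (n mod 6 = 0 \<longrightarrow> (\<exists>A B C. Os = [A, B, C] \<and>
      real (card A) = real n ^ 2 + 3 * real n - 5 \<and> lower_singletons 1 n {2} \<subseteq> A \<and>
      real (card B) = real n ^ 2 + real n - 12 \<and> lower_singletons 1 n {0, 4} \<subseteq> B \<and>
      real (card C) = real n ^ 2 + real n - 13 \<and> lower_singletons 2 n {1, 3, 5} \<subseteq> C)) \<and>
    (n mod 6 = 1 \<longrightarrow> (\<exists>A B C D. Os = [A, B, C, D] \<and>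
      real (card A) = real n ^ 2 + 2 * real n - 9 \<and> lower_singletons 1 n {2, 5} \<subseteq> A \<and>
      real (card B) = real n ^ 2 + 2 * real n - 9 \<and> lower_singletons 1 n {0, 3} \<subseteq> B \<and>
      real (card C) = (2 * real n ^ 2 + real n - 27) / 3 \<and> lower_singletons 2 n {1, 4} \<subseteq> C \<and>
      real (card D) = (real n ^ 2 + 2 * real n - 9) / 3 \<and> (\<forall>x. {x} \<notin> D) \<and>
        {(1, n - 2), (1, n - 1)} \<in> D)) \<and>
    (n mod 6 = 2 \<longrightarrow> (\<exists>A B C. Os = [A, B, C] \<and>
      real (card A) = real n ^ 2 + 3 * real n - 4 \<and> lower_singletons 1 n {2, 4} \<subseteq> A \<and>
      real (card B) = real n ^ 2 + real n - 13 \<and> lower_singletons 1 n {0} \<subseteq> B \<and>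
      real (card C) = real n ^ 2 + real n - 13 \<and> lower_singletons 2 n {1, 3, 5} \<subseteq> C)) \<and>
    (n mod 6 = 3 \<longrightarrow> (\<exists>A B. Os = [A, B] \<and>
      real (card A) = 2 * real n ^ 2 + 5 * real n - 13 \<and> lower_singletons 1 n {2, 3, 4, 5} \<subseteq> A \<and>
      real (card B) = real n ^ 2 - 17 \<and> lower_singletons 2 n {0, 1} \<subseteq> B)) \<and>
    (n mod 6 = 4 \<longrightarrow> (\<exists>A B C D E F G. Os = [A, B, C, D, E, F, G] \<and>
      real (card A) = (2 * real n ^ 2 + 4 * real n - 18) / 3 \<and> lower_singletons 1 n {0} \<subseteq> A \<and>
      real (card B) = (2 * real n ^ 2 + 4 * real n - 18) / 3 \<and> lower_singletons 1 n {2} \<subseteq> B \<and>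
      real (card C) = (real n ^ 2 + 2 * real n - 6) / 3 \<and> lower_singletons 1 n {4} \<subseteq> C \<and>
      real (card D) = (real n ^ 2 + 2 * real n - 9) / 3 \<and> lower_singletons 1 n {3} \<subseteq> D \<and>
      real (card E) = (real n ^ 2 + 2 * real n - 9) / 3 \<and> lower_singletons 1 n {5} \<subseteq> E \<and>
      real (card F) = (real n ^ 2 - real n - 21) / 3 \<and> lower_singletons 2 n {1} \<subseteq> F \<and>
      real (card G) = (real n ^ 2 + 2 * real n - 9) / 3 \<and> (\<forall>x. {x} \<notin> G) \<and>
        {(1, n - 2), (1, n - 1)} \<in> G)) \<and>
    (n mod 6 = 5 \<longrightarrow> (\<exists>A B. Os = [A, B] \<and>
      real (card A) = 2 * real n ^ 2 + 3 * real n - 21 \<and> lower_singletons 1 n {0, 3, 4, 5} \<subseteq> A \<and>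
      real (card B) = real n ^ 2 + 2 * real n - 9 \<and> lower_singletons 2 n {1, 2} \<subseteq> B))"
proof -
  have n: "5 \<le> n" using assms by simp
  \<comment> \<open>Remainders are taken from 5 to 10 rather than from 0 to 5, so that the
    differences \<open>r - 4\<close> to \<open>r - 1\<close> in the link table are exact.\<close>
  define r where "r = 5 + (n - 5) mod 6"
  define q where "q = (n - 5) div 6"
  have nqr: "n = 6 * q + r" "5 \<le> r" unfolding q_def r_def using n by (simp_all add: mult.commute[of 6])
  have q: "real q = (real n - real r) / 6" using nqr(1) by simp
  note w = real_weight[OF nqr] and wD = real_weight_Diag[OF nqr]
  have "r \<le> 10" unfolding r_def using mod_less_divisor[of 6 "n - 5"] by linarith
  then have "r = 5 \<or> r = 6 \<or> r = 7 \<or> r = 8 \<or> r = 9 \<or> r = 10"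
    using nqr(2) by linarith
  moreover have "n mod 6 = r mod 6" unfolding nqr(1) by simp
  ultimately consider "n mod 6 = 0" "r = 6" | "n mod 6 = 1" "r = 7" | "n mod 6 = 2" "r = 8"
    | "n mod 6 = 3" "r = 9" | "n mod 6 = 4" "r = 10" | "n mod 6 = 5" "r = 5"
    by (elim disjE) simp_all
  then show ?thesis
  proof cases
    case 1
    \<comment> \<open>As a permutation this table has the cycles (4 8 7), (2 6 0) and (1 3 5), one
      for each orbit; the cases below read off their cycles in the same way.\<close>
    have link: "link n 0 = 2" "link n 1 = 3" "link n 2 = 6" "link n 3 = 5" "link n 4 = 8" "link n 5 = 1" "link n 6 = 0" "link n 7 = 4" "link n 8 = 7"
      unfolding link_residue[OF nqr] 1(2) by simp_all
    have A: "linked n (set [4, 8, 7]) (class_orbit n 4)"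
      using linked_cycle[OF n, of "[4, 8, 7]"] link by simp
    have card_A: "real (card (class_orbit n 4)) = real n ^ 2 + 3 * real n - 5"
      using w[of 4] wD[of 2] wD[of 1] unfolding linked_card[OF n A]
      by (simp add: 1(2) q field_simps power2_eq_square)
    \<comment> \<open>The residue \<open>i mod 6\<close> belongs to the class
      \<open>(n - i) mod 6\<close>, here 4. Classes 7 and 8 come from \<open>Diag\<close> and
      receive no residue.\<close>
    have single_A: "lower_singletons 1 n {2} \<subseteq> class_orbit n 4"
      by (rule lower_singletons_subset[OF n A]) (use 1(1) in auto)
    have B: "linked n (set [2, 6, 0]) (class_orbit n 2)"
      using linked_cycle[OF n, of "[2, 6, 0]"] link by simp
    have card_B: "real (card (class_orbit n 2)) = real n ^ 2 + real n - 12"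
      using w[of 2] wD[of 0] w[of 0] unfolding linked_card[OF n B]
      by (simp add: 1(2) q field_simps power2_eq_square)
    have single_B: "lower_singletons 1 n {0, 4} \<subseteq> class_orbit n 2"
      by (rule lower_singletons_subset[OF n B]) (use 1(1) in auto)
    have C: "linked n (set [1, 3, 5]) (class_orbit n 1)"
      using linked_cycle[OF n, of "[1, 3, 5]"] link by simp
    have card_C: "real (card (class_orbit n 1)) = real n ^ 2 + real n - 13"
      using w[of 1] w[of 3] w[of 5] unfolding linked_card[OF n C]
      by (simp add: 1(2) q field_simps power2_eq_square)
    have single_C: "lower_singletons 2 n {1, 3, 5} \<subseteq> class_orbit n 1"
      by (rule lower_singletons_subset[OF n C]) (use 1(1) in auto)
    have "list_all2 (linked n) [set [4, 8, 7], set [2, 6, 0], set [1, 3, 5]] [class_orbit n 4, class_orbit n 2, class_orbit n 1]"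
      using A B C by simp
    note common = linked_orbits[OF n this]
    show ?thesis
      by (rule exI[of _ "[class_orbit n 4, class_orbit n 2, class_orbit n 1]"])
        (use common card_A card_B card_C single_A single_B single_C 1(1) in \<open>simp add: field_simps\<close>)
  next
    case 2
    have link: "link n 0 = 3" "link n 1 = 4" "link n 2 = 7" "link n 3 = 0" "link n 4 = 6" "link n 5 = 2" "link n 6 = 1" "link n 7 = 5" "link n 8 = 8"
      unfolding link_residue[OF nqr] 2(2) by simp_all
    have A: "linked n (set [2, 7, 5]) (class_orbit n 2)"
      using linked_cycle[OF n, of "[2, 7, 5]"] link by simp
    have card_A: "real (card (class_orbit n 2)) = real n ^ 2 + 2 * real n - 9"
      using w[of 2] wD[of 1] w[of 5] unfolding linked_card[OF n A]
      by (simp add: 2(2) q field_simps power2_eq_square)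
    have single_A: "lower_singletons 1 n {2, 5} \<subseteq> class_orbit n 2"
      by (rule lower_singletons_subset[OF n A]) (use 2(1) in auto)
    have B: "linked n (set [4, 6, 1]) (class_orbit n 4)"
      using linked_cycle[OF n, of "[4, 6, 1]"] link by simp
    have card_B: "real (card (class_orbit n 4)) = real n ^ 2 + 2 * real n - 9"
      using w[of 4] wD[of 0] w[of 1] unfolding linked_card[OF n B]
      by (simp add: 2(2) q field_simps power2_eq_square)
    have single_B: "lower_singletons 1 n {0, 3} \<subseteq> class_orbit n 4"
      by (rule lower_singletons_subset[OF n B]) (use 2(1) in auto)
    have C: "linked n (set [3, 0]) (class_orbit n 3)"
      using linked_cycle[OF n, of "[3, 0]"] link by simp
    have card_C: "real (card (class_orbit n 3)) = (2 * real n ^ 2 + real n - 27) / 3"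
      using w[of 3] w[of 0] unfolding linked_card[OF n C]
      by (simp add: 2(2) q field_simps power2_eq_square)
    have single_C: "lower_singletons 2 n {1, 4} \<subseteq> class_orbit n 3"
      by (rule lower_singletons_subset[OF n C]) (use 2(1) in auto)
    have D: "linked n (set [8]) (class_orbit n 8)"
      using linked_cycle[OF n, of "[8]"] link by simp
    have card_D: "real (card (class_orbit n 8)) = (real n ^ 2 + 2 * real n - 9) / 3"
      using wD[of 2] unfolding linked_card[OF n D]
      by (simp add: 2(2) q field_simps power2_eq_square)
    \<comment> \<open>Class 8 is a cycle of its own exactly when \<open>n mod 3 = 1\<close>, that
      is, here and for \<open>n mod 6 = 4\<close>.\<close>
    have "n mod 3 = 1" using 2(1) by presburger
    then have no_single: "\<forall>x. {x} \<notin> class_orbit n 8" using no_singleton[OF n] D by simp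
    have pair: "{(1, n - 2), (1, n - 1)} \<in> class_orbit n 8"
      using class_8_pair_in_orbit[OF n D] by simp
    have "list_all2 (linked n) [set [2, 7, 5], set [4, 6, 1], set [3, 0], set [8]] [class_orbit n 2, class_orbit n 4, class_orbit n 3, class_orbit n 8]"
      using A B C D by simp
    note common = linked_orbits[OF n this]
    show ?thesis
      by (rule exI[of _ "[class_orbit n 2, class_orbit n 4, class_orbit n 3, class_orbit n 8]"])
        (use common card_A card_B card_C card_D single_A single_B single_C no_single pair 2(1) in \<open>simp add: field_simps\<close>)
  next
    case 3
    have link: "link n 0 = 4" "link n 1 = 5" "link n 2 = 8" "link n 3 = 1" "link n 4 = 7" "link n 5 = 3" "link n 6 = 2" "link n 7 = 0" "link n 8 = 6"
      unfolding link_residue[OF nqr] 3(2) by simp_all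
    have A: "linked n (set [4, 7, 0]) (class_orbit n 4)"
      using linked_cycle[OF n, of "[4, 7, 0]"] link by simp
    have card_A: "real (card (class_orbit n 4)) = real n ^ 2 + 3 * real n - 4"
      using w[of 4] wD[of 1] w[of 0] unfolding linked_card[OF n A]
      by (simp add: 3(2) q field_simps power2_eq_square)
    have single_A: "lower_singletons 1 n {2, 4} \<subseteq> class_orbit n 4"
      by (rule lower_singletons_subset[OF n A]) (use 3(1) in auto)
    have B: "linked n (set [2, 8, 6]) (class_orbit n 2)"
      using linked_cycle[OF n, of "[2, 8, 6]"] link by simp
    have card_B: "real (card (class_orbit n 2)) = real n ^ 2 + real n - 13"
      using w[of 2] wD[of 2] wD[of 0] unfolding linked_card[OF n B]
      by (simp add: 3(2) q field_simps power2_eq_square)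
    have single_B: "lower_singletons 1 n {0} \<subseteq> class_orbit n 2"
      by (rule lower_singletons_subset[OF n B]) (use 3(1) in auto)
    have C: "linked n (set [3, 1, 5]) (class_orbit n 3)"
      using linked_cycle[OF n, of "[3, 1, 5]"] link by simp
    have card_C: "real (card (class_orbit n 3)) = real n ^ 2 + real n - 13"
      using w[of 3] w[of 1] w[of 5] unfolding linked_card[OF n C]
      by (simp add: 3(2) q field_simps power2_eq_square)
    have single_C: "lower_singletons 2 n {1, 3, 5} \<subseteq> class_orbit n 3"
      by (rule lower_singletons_subset[OF n C]) (use 3(1) in auto)
    have "list_all2 (linked n) [set [4, 7, 0], set [2, 8, 6], set [3, 1, 5]] [class_orbit n 4, class_orbit n 2, class_orbit n 3]"
      using A B C by simp
    note common = linked_orbits[OF n this]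
    show ?thesis
      by (rule exI[of _ "[class_orbit n 4, class_orbit n 2, class_orbit n 3]"])
        (use common card_A card_B card_C single_A single_B single_C 3(1) in \<open>simp add: field_simps\<close>)
  next
    case 4
    have link: "link n 0 = 5" "link n 1 = 0" "link n 2 = 6" "link n 3 = 2" "link n 4 = 8" "link n 5 = 4" "link n 6 = 3" "link n 7 = 1" "link n 8 = 7"
      unfolding link_residue[OF nqr] 4(2) by simp_all
    have A: "linked n (set [4, 8, 7, 1, 0, 5]) (class_orbit n 4)"
      using linked_cycle[OF n, of "[4, 8, 7, 1, 0, 5]"] link by simp
    have card_A: "real (card (class_orbit n 4)) = 2 * real n ^ 2 + 5 * real n - 13"
      using w[of 4] wD[of 2] wD[of 1] w[of 1] w[of 0] w[of 5] unfolding linked_card[OF n A]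
      by (simp add: 4(2) q field_simps power2_eq_square)
    have single_A: "lower_singletons 1 n {2, 3, 4, 5} \<subseteq> class_orbit n 4"
      by (rule lower_singletons_subset[OF n A]) (use 4(1) in auto)
    have B: "linked n (set [2, 6, 3]) (class_orbit n 2)"
      using linked_cycle[OF n, of "[2, 6, 3]"] link by simp
    have card_B: "real (card (class_orbit n 2)) = real n ^ 2 - 17"
      using w[of 2] wD[of 0] w[of 3] unfolding linked_card[OF n B]
      by (simp add: 4(2) q field_simps power2_eq_square)
    have single_B: "lower_singletons 2 n {0, 1} \<subseteq> class_orbit n 2"
      by (rule lower_singletons_subset[OF n B]) (use 4(1) in auto)
    have "list_all2 (linked n) [set [4, 8, 7, 1, 0, 5], set [2, 6, 3]] [class_orbit n 4, class_orbit n 2]"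
      using A B by simp
    note common = linked_orbits[OF n this]
    show ?thesis
      by (rule exI[of _ "[class_orbit n 4, class_orbit n 2]"])
        (use common card_A card_B single_A single_B 4(1) in \<open>simp add: field_simps\<close>)
  next
    case 5
    \<comment> \<open>The classes 0, 1, 3, 5 and 8 are fixed points and only (4 6) and (2 7) are
      proper cycles; hence seven orbits.\<close>
    have link: "link n 0 = 0" "link n 1 = 1" "link n 2 = 7" "link n 3 = 3" "link n 4 = 6" "link n 5 = 5" "link n 6 = 4" "link n 7 = 2" "link n 8 = 8"
      unfolding link_residue[OF nqr] 5(2) by simp_all
    have A: "linked n (set [4, 6]) (class_orbit n 4)"
      using linked_cycle[OF n, of "[4, 6]"] link by simp
    have card_A: "real (card (class_orbit n 4)) = (2 * real n ^ 2 + 4 * real n - 18) / 3"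
      using w[of 4] wD[of 0] unfolding linked_card[OF n A]
      by (simp add: 5(2) q field_simps power2_eq_square)
    have single_A: "lower_singletons 1 n {0} \<subseteq> class_orbit n 4"
      by (rule lower_singletons_subset[OF n A]) (use 5(1) in auto)
    have B: "linked n (set [2, 7]) (class_orbit n 2)"
      using linked_cycle[OF n, of "[2, 7]"] link by simp
    have card_B: "real (card (class_orbit n 2)) = (2 * real n ^ 2 + 4 * real n - 18) / 3"
      using w[of 2] wD[of 1] unfolding linked_card[OF n B]
      by (simp add: 5(2) q field_simps power2_eq_square)
    have single_B: "lower_singletons 1 n {2} \<subseteq> class_orbit n 2"
      by (rule lower_singletons_subset[OF n B]) (use 5(1) in auto)
    have C: "linked n (set [0]) (class_orbit n 0)"
      using linked_cycle[OF n, of "[0]"] link by simp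
    have card_C: "real (card (class_orbit n 0)) = (real n ^ 2 + 2 * real n - 6) / 3"
      using w[of 0] unfolding linked_card[OF n C]
      by (simp add: 5(2) q field_simps power2_eq_square)
    have single_C: "lower_singletons 1 n {4} \<subseteq> class_orbit n 0"
      by (rule lower_singletons_subset[OF n C]) (use 5(1) in auto)
    have D: "linked n (set [1]) (class_orbit n 1)"
      using linked_cycle[OF n, of "[1]"] link by simp
    have card_D: "real (card (class_orbit n 1)) = (real n ^ 2 + 2 * real n - 9) / 3"
      using w[of 1] unfolding linked_card[OF n D]
      by (simp add: 5(2) q field_simps power2_eq_square)
    have single_D: "lower_singletons 1 n {3} \<subseteq> class_orbit n 1"
      by (rule lower_singletons_subset[OF n D]) (use 5(1) in auto)
    have E: "linked n (set [5]) (class_orbit n 5)"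
      using linked_cycle[OF n, of "[5]"] link by simp
    have card_E: "real (card (class_orbit n 5)) = (real n ^ 2 + 2 * real n - 9) / 3"
      using w[of 5] unfolding linked_card[OF n E]
      by (simp add: 5(2) q field_simps power2_eq_square)
    have single_E: "lower_singletons 1 n {5} \<subseteq> class_orbit n 5"
      by (rule lower_singletons_subset[OF n E]) (use 5(1) in auto)
    have F: "linked n (set [3]) (class_orbit n 3)"
      using linked_cycle[OF n, of "[3]"] link by simp
    have card_F: "real (card (class_orbit n 3)) = (real n ^ 2 - real n - 21) / 3"
      using w[of 3] unfolding linked_card[OF n F]
      by (simp add: 5(2) q field_simps power2_eq_square)
    have single_F: "lower_singletons 2 n {1} \<subseteq> class_orbit n 3"
      by (rule lower_singletons_subset[OF n F]) (use 5(1) in auto)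
    have G: "linked n (set [8]) (class_orbit n 8)"
      using linked_cycle[OF n, of "[8]"] link by simp
    have card_G: "real (card (class_orbit n 8)) = (real n ^ 2 + 2 * real n - 9) / 3"
      using wD[of 2] unfolding linked_card[OF n G]
      by (simp add: 5(2) q field_simps power2_eq_square)
    have "n mod 3 = 1" using 5(1) by presburger
    then have no_single: "\<forall>x. {x} \<notin> class_orbit n 8" using no_singleton[OF n] G by simp
    have pair: "{(1, n - 2), (1, n - 1)} \<in> class_orbit n 8"
      using class_8_pair_in_orbit[OF n G] by simp
    have "list_all2 (linked n) [set [4, 6], set [2, 7], set [0], set [1], set [5], set [3], set [8]] [class_orbit n 4, class_orbit n 2, class_orbit n 0, class_orbit n 1, class_orbit n 5, class_orbit n 3, class_orbit n 8]"
      using A B C D E F G by simp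
    note common = linked_orbits[OF n this]
    show ?thesis
      by (rule exI[of _ "[class_orbit n 4, class_orbit n 2, class_orbit n 0, class_orbit n 1, class_orbit n 5, class_orbit n 3, class_orbit n 8]"])
        (use common card_A card_B card_C card_D card_E card_F card_G single_A single_B single_C single_D single_E single_F no_single pair 5(1) in \<open>simp add: field_simps\<close>)
  next
    case 6
    have link: "link n 0 = 1" "link n 1 = 2" "link n 2 = 8" "link n 3 = 4" "link n 4 = 7" "link n 5 = 0" "link n 6 = 5" "link n 7 = 3" "link n 8 = 6"
      unfolding link_residue[OF nqr] 6(2) by simp_all
    have A: "linked n (set [0, 1, 2, 8, 6, 5]) (class_orbit n 0)"
      using linked_cycle[OF n, of "[0, 1, 2, 8, 6, 5]"] link by simp
    have card_A: "real (card (class_orbit n 0)) = 2 * real n ^ 2 + 3 * real n - 21"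
      using w[of 0] w[of 1] w[of 2] wD[of 2] wD[of 0] w[of 5] unfolding linked_card[OF n A]
      by (simp add: 6(2) q field_simps power2_eq_square)
    have single_A: "lower_singletons 1 n {0, 3, 4, 5} \<subseteq> class_orbit n 0"
      by (rule lower_singletons_subset[OF n A]) (use 6(1) in auto)
    have B: "linked n (set [3, 4, 7]) (class_orbit n 3)"
      using linked_cycle[OF n, of "[3, 4, 7]"] link by simp
    have card_B: "real (card (class_orbit n 3)) = real n ^ 2 + 2 * real n - 9"
      using w[of 3] w[of 4] wD[of 1] unfolding linked_card[OF n B]
      by (simp add: 6(2) q field_simps power2_eq_square)
    \<comment> \<open>The range starts at 2 because \<open>{(1, 1)}\<close> has residue 1 but leads
      to \<open>Full (n - 1)\<close>, outside the section.\<close>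
    have single_B: "lower_singletons 2 n {1, 2} \<subseteq> class_orbit n 3"
      by (rule lower_singletons_subset[OF n B]) (use 6(1) in auto)
    have "list_all2 (linked n) [set [0, 1, 2, 8, 6, 5], set [3, 4, 7]] [class_orbit n 0, class_orbit n 3]"
      using A B by simp
    note common = linked_orbits[OF n this]
    show ?thesis
      by (rule exI[of _ "[class_orbit n 0, class_orbit n 3]"])
        (use common card_A card_B single_A single_B 6(1) in \<open>simp add: field_simps\<close>)
  qed
qed

end
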